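(* Let $0<p,q\le\infty$ and let $Z_{p,q}=\ell_q(\ell_p)$ (with the convention that $\ell_\infty$ means $c_0$). If $\mathcal{X}=(\boldsymbol{x}_n)_{n=1}^\infty$ is a squeeze-symmetric sequence in $Z_{p,q}$, then there is $r\in\{p,q\}$ such that $$\boldsymbol{\varphi_u^s}[\mathcal{X},Z_{p,q}](m)\approx m^{1/r},\qquad m\in\mathbb{N}$$ (where $m^{1/\infty}=1$).
   Context: $\ell_q(\ell_p)$ is the space of sequences $(f_n)_{n=1}^\infty$ in $\ell_p$ such that $(\|f_n\|_p)_n\in\ell_q$, with the quasi-norm $\|(\|f_n\|_p)_n\|_q$ (with $c_0$ replacing $\ell_\infty$). $a_m\approx b_m$ means equivalence up to multiplicative constants independent of $m$. $\mathbb{F}$ is $\mathbb{R}$ or $\mathbb{C}$ and $\mathbb{E}$ is the set of scalars of modulus 1. For a sequence $\mathcal{X}=(\boldsymbol{x}_n)$ in a quasi-Banach space $\mathbb{X}$, $\boldsymbol{\varphi_u^s}[\mathcal{X},\mathbb{X}](m)=\sup\{\|\sum_{n\in A}\varepsilon_n\boldsymbol{x}_n\|\colon|A|\le m,\ \varepsilon\in\mathbb{E}^A\}$. A symmetric sequence space is a quasi-Banach space $\mathbb{S}\subseteq\mathbb{F}^{\mathbb{N}}$ for which the unit vector system $(\boldsymbol{e}_n)$ is a Schauder basis and $\|\sum_n\varepsilon_na_n\boldsymbol{e}_{\pi(n)}\|=\|\sum_na_n\boldsymbol{e}_n\|$ for all signs $\varepsilon_n\in\mathbb{E}$ and permutations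 $\pi$ of $\mathbb{N}$; $\Lambda_m[\mathbb{S}]=\|\sum_{n\in A}\boldsymbol{e}_n\|_{\mathbb{S}}$ for $|A|=m$. A biorthogonal system $(\boldsymbol{x}_n,\boldsymbol{x}_n^* )_{n=1}^\infty$ in $\mathbb{X}\times\mathbb{X}^*$ (its vectors are not assumed to span $\mathbb{X}$) is squeezed between symmetric sequence spaces $\mathbb{S}_1$ and $\mathbb{S}_2$ if the series transform $(a_n)\mapsto\sum_na_n\boldsymbol{x}_n$ is bounded from $\mathbb{S}_1$ into $\mathbb{X}$ and the coefficient transform $f\mapsto(\boldsymbol{x}_n^*(f))_n$ is bounded from $\mathbb{X}$ into $\mathbb{S}_2$. It is squeeze-symmetric if this holds for some $\mathbb{S}_1,\mathbb{S}_2$ with $\Lambda_m[\mathbb{S}_1]\approx\Lambda_m[\mathbb{S}_2]$. A sequence $(\boldsymbol{x}_n)$ in $\mathbb{X}$ is squeeze-symmetric if there is $(\boldsymbol{x}_n^* )$ in $\mathbb{X}^*$ such that $(\boldsymbol{x}_n,\boldsymbol{x}_n^* )$ is a squeeze-symmetric biorthogonal system. *)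

theory Defs
  imports "HOL-Analysis.Analysis" "HOL-Library.Function_Algebras"
begin

text \<open>
  Spaces are represented by a carrier set \<open>V\<close> and a functional \<open>N\<close> inside an ambient
  vector space. For sequences the ambient addition is the pointwise one of
  \<open>Function_Algebras\<close>. The scalar field is left generic here; the intended instances are
  \<open>real\<close> and \<open>complex\<close>.
\<close>

definition seq_scale :: "'a::real_normed_field \<Rightarrow> (nat \<Rightarrow> 'a) \<Rightarrow> (nat \<Rightarrow> 'a)" where
  "seq_scale c a = (\<lambda>n. c * a n)"

definition mixed_scale ::
  "'a::real_normed_field \<Rightarrow> (nat \<Rightarrow> nat \<Rightarrow> 'a) \<Rightarrow> (nat \<Rightarrow> nat \<Rightarrow> 'a)" where
  "mixed_scale c f = (\<lambda>n. seq_scale c (f n))"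

lemma vector_space_seq_scale: "vector_space seq_scale"
  by unfold_locales (auto simp: seq_scale_def fun_eq_iff algebra_simps)

lemma vector_space_mixed_scale: "vector_space mixed_scale"
  by unfold_locales (auto simp: mixed_scale_def seq_scale_def fun_eq_iff algebra_simps)

locale quasi_banach_space = vector_space scl
  for scl :: "'a::real_normed_field \<Rightarrow> 'b::ab_group_add \<Rightarrow> 'b" +
  fixes V :: "'b set" and N :: "'b \<Rightarrow> real"
  assumes subspace_carrier: "subspace V"
    and qnorm_nonneg: "f \<in> V \<Longrightarrow> 0 \<le> N f"
    and qnorm_eq_0_iff: "f \<in> V \<Longrightarrow> N f = 0 \<longleftrightarrow> f = 0"
    and qnorm_scale: "f \<in> V \<Longrightarrow> N (scl c f) = norm c * N f"
    and qnorm_quasi_triangle: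
      "\<exists>K. \<forall>f\<in>V. \<forall>g\<in>V. N (f + g) \<le> K * (N f + N g)"
    and qnorm_complete:
      "(\<And>n. u n \<in> V) \<Longrightarrow>
       (\<And>e. e > 0 \<Longrightarrow> \<exists>M. \<forall>m\<ge>M. \<forall>n\<ge>M. N (u m - u n) < e) \<Longrightarrow>
       \<exists>f\<in>V. (\<lambda>n. N (u n - f)) \<longlonglongrightarrow> 0"

definition qnorm_sums :: "('b::ab_group_add \<Rightarrow> real) \<Rightarrow> (nat \<Rightarrow> 'b) \<Rightarrow> 'b \<Rightarrow> bool" where
  "qnorm_sums N u f \<longleftrightarrow> (\<lambda>m. N ((\<Sum>n<m. u n) - f)) \<longlonglongrightarrow> 0"

definition schauder_basis ::
  "('a::real_normed_field \<Rightarrow> 'b::ab_group_add \<Rightarrow> 'b) \<Rightarrow> 'b set \<Rightarrow> ('b \<Rightarrow> real) \<Rightarrow> (nat \<Rightarrow> 'b) \<Rightarrow> bool"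
where
  "schauder_basis scl V N x \<longleftrightarrow>
     (\<forall>n. x n \<in> V) \<and> (\<forall>f\<in>V. \<exists>!a. qnorm_sums N (\<lambda>n. scl (a n) (x n)) f)"

text \<open>The dual space; functionals are unconstrained outside the carrier \<open>V\<close>.\<close>

definition dual_space ::
  "('a::real_normed_field \<Rightarrow> 'b::ab_group_add \<Rightarrow> 'b) \<Rightarrow> 'b set \<Rightarrow> ('b \<Rightarrow> real) \<Rightarrow> ('b \<Rightarrow> 'a) set"
where
  "dual_space scl V N = {\<phi>.
     (\<forall>f\<in>V. \<forall>g\<in>V. \<phi> (f + g) = \<phi> f + \<phi> g) \<and>
     (\<forall>c. \<forall>f\<in>V. \<phi> (scl c f) = c * \<phi> f) \<and>
     (\<exists>C. \<forall>f\<in>V. norm (\<phi> f) \<le> C * N f)}"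

definition unit_seq :: "nat \<Rightarrow> (nat \<Rightarrow> 'a::real_normed_field)" where
  "unit_seq n = (\<lambda>k. if k = n then 1 else 0)"

text \<open>
  The third conjunct expresses that \<open>S\<close> is a space of sequences in which \<open>a = (a\<^sub>n)\<close> is
  identified with \<open>\<Sum>\<^sub>n a\<^sub>n e\<^sub>n\<close>. So in the last conjunct \<open>N a\<close> is the quasi-norm of
  \<open>\<Sum>\<^sub>n a\<^sub>n e\<^sub>n\<close>, and \<open>g\<close> is the sum of \<open>\<Sum>\<^sub>n \<epsilon>\<^sub>n a\<^sub>n e\<^bsub>\<pi>(n)\<^esub>\<close>.
\<close>

definition symmetric_sequence_space ::
  "(nat \<Rightarrow> 'a::real_normed_field) set \<Rightarrow> ((nat \<Rightarrow> 'a) \<Rightarrow> real) \<Rightarrow> bool" where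
  "symmetric_sequence_space S N \<longleftrightarrow>
     quasi_banach_space seq_scale S N \<and>
     schauder_basis seq_scale S N unit_seq \<and>
     (\<forall>a\<in>S. qnorm_sums N (\<lambda>n. seq_scale (a n) (unit_seq n)) a) \<and>
     (\<forall>a\<in>S. \<forall>\<epsilon> \<pi>. (\<forall>n. norm (\<epsilon> n) = 1) \<longrightarrow> bij \<pi> \<longrightarrow>
        (\<exists>g\<in>S. qnorm_sums N (\<lambda>n. seq_scale (\<epsilon> n * a n) (unit_seq (\<pi> n))) g \<and> N g = N a))"

text \<open>By symmetry the choice of the set of size \<open>m\<close> is immaterial.\<close>

definition Lambda :: "((nat \<Rightarrow> 'a::real_normed_field) \<Rightarrow> real) \<Rightarrow> nat \<Rightarrow> real" where
  "Lambda N m = N (\<Sum>n<m. unit_seq n)"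

text \<open>The sequences compared are indexed by the positive integers; the value at \<open>0\<close> is ignored.\<close>

definition seq_equivalent :: "(nat \<Rightarrow> ennreal) \<Rightarrow> (nat \<Rightarrow> ennreal) \<Rightarrow> bool" where
  "seq_equivalent a b \<longleftrightarrow>
     (\<exists>C>0::real. \<forall>m\<ge>1. a m \<le> ennreal C * b m \<and> b m \<le> ennreal C * a m)"

definition biorthogonal_system ::
  "('a::real_normed_field \<Rightarrow> 'b::ab_group_add \<Rightarrow> 'b) \<Rightarrow> 'b set \<Rightarrow> ('b \<Rightarrow> real) \<Rightarrow>
   (nat \<Rightarrow> 'b) \<Rightarrow> (nat \<Rightarrow> 'b \<Rightarrow> 'a) \<Rightarrow> bool" where
  "biorthogonal_system scl V N x xs \<longleftrightarrow>
     (\<forall>n. x n \<in> V) \<and> (\<forall>n. xs n \<in> dual_space scl V N) \<and>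
     (\<forall>m n. xs m (x n) = (if m = n then 1 else 0))"

definition series_transform_bounded ::
  "('a::real_normed_field \<Rightarrow> 'b::ab_group_add \<Rightarrow> 'b) \<Rightarrow> 'b set \<Rightarrow> ('b \<Rightarrow> real) \<Rightarrow>
   (nat \<Rightarrow> 'b) \<Rightarrow> (nat \<Rightarrow> 'a) set \<Rightarrow> ((nat \<Rightarrow> 'a) \<Rightarrow> real) \<Rightarrow> bool" where
  "series_transform_bounded scl V N x S NS \<longleftrightarrow>
     (\<exists>C. \<forall>a\<in>S. \<exists>f\<in>V. qnorm_sums N (\<lambda>n. scl (a n) (x n)) f \<and> N f \<le> C * NS a)"

definition coefficient_transform_bounded ::
  "'b set \<Rightarrow> ('b \<Rightarrow> real) \<Rightarrow> (nat \<Rightarrow> 'b \<Rightarrow> 'a) \<Rightarrow> (nat \<Rightarrow> 'a) set \<Rightarrow> ((nat \<Rightarrow> 'a) \<Rightarrow> real) \<Rightarrow> bool"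
where
  "coefficient_transform_bounded V N xs S NS \<longleftrightarrow>
     (\<exists>C. \<forall>f\<in>V. (\<lambda>n. xs n f) \<in> S \<and> NS (\<lambda>n. xs n f) \<le> C * N f)"

definition squeeze_symmetric_system ::
  "('a::real_normed_field \<Rightarrow> 'b::ab_group_add \<Rightarrow> 'b) \<Rightarrow> 'b set \<Rightarrow> ('b \<Rightarrow> real) \<Rightarrow>
   (nat \<Rightarrow> 'b) \<Rightarrow> (nat \<Rightarrow> 'b \<Rightarrow> 'a) \<Rightarrow> bool" where
  "squeeze_symmetric_system scl V N x xs \<longleftrightarrow>
     biorthogonal_system scl V N x xs \<and>
     (\<exists>S1 N1 S2 N2.
        symmetric_sequence_space S1 N1 \<and> symmetric_sequence_space S2 N2 \<and>
        series_transform_bounded scl V N x S1 N1 \<and>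
        coefficient_transform_bounded V N xs S2 N2 \<and>
        seq_equivalent (\<lambda>m. ennreal (Lambda N1 m)) (\<lambda>m. ennreal (Lambda N2 m)))"

definition squeeze_symmetric_sequence ::
  "('a::real_normed_field \<Rightarrow> 'b::ab_group_add \<Rightarrow> 'b) \<Rightarrow> 'b set \<Rightarrow> ('b \<Rightarrow> real) \<Rightarrow>
   (nat \<Rightarrow> 'b) \<Rightarrow> bool" where
  "squeeze_symmetric_sequence scl V N x \<longleftrightarrow> (\<exists>xs. squeeze_symmetric_system scl V N x xs)"

text \<open>The supremum is taken in \<open>ennreal\<close>, as it may be infinite for a general sequence.\<close>

definition phi_us ::
  "('a::real_normed_field \<Rightarrow> 'b::ab_group_add \<Rightarrow> 'b) \<Rightarrow> ('b \<Rightarrow> real) \<Rightarrow> (nat \<Rightarrow> 'b) \<Rightarrow> nat \<Rightarrow> ennreal"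
where
  "phi_us scl N x m =
     Sup {ennreal (N (\<Sum>n\<in>A. scl (\<epsilon> n) (x n))) | A \<epsilon>.
            finite A \<and> card A \<le> m \<and> (\<forall>n\<in>A. norm (\<epsilon> n) = 1)}"

text \<open>\<open>\<ell>\<^sub>p\<close>, with \<open>c\<^sub>0\<close> for \<open>p = \<infinity>\<close>.\<close>

definition lp_space :: "ennreal \<Rightarrow> (nat \<Rightarrow> 'a::real_normed_vector) set" where
  "lp_space p = (if p = \<infinity> then {a. a \<longlonglongrightarrow> 0}
                 else {a. summable (\<lambda>n. norm (a n) powr enn2real p)})"

definition lp_norm :: "ennreal \<Rightarrow> (nat \<Rightarrow> 'a::real_normed_vector) \<Rightarrow> real" where
  "lp_norm p a = (if p = \<infinity> then (SUP n. norm (a n))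
                  else (\<Sum>n. norm (a n) powr enn2real p) powr (1 / enn2real p))"

text \<open>The space \<open>Z\<^sub>p\<^sub>,\<^sub>q = \<ell>\<^sub>q(\<ell>\<^sub>p)\<close>; note the order of the arguments.\<close>

definition mixed_space :: "ennreal \<Rightarrow> ennreal \<Rightarrow> (nat \<Rightarrow> nat \<Rightarrow> 'a::real_normed_field) set" where
  "mixed_space p q = {f. (\<forall>n. f n \<in> lp_space p) \<and> (\<lambda>n. lp_norm p (f n)) \<in> lp_space q}"

definition mixed_norm :: "ennreal \<Rightarrow> ennreal \<Rightarrow> (nat \<Rightarrow> nat \<Rightarrow> 'a::real_normed_field) \<Rightarrow> real" where
  "mixed_norm p q f = lp_norm q (\<lambda>n. lp_norm p (f n))"

end

theory Submission
  imports Defs "HOL-Complex_Analysis.Great_Picard"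
begin

text \<open>Squeeze-symmetry makes \<open>\<parallel>\<Sum>\<^bsub>n\<in>A\<^esub> \<epsilon>\<^sub>n x\<^sub>n\<parallel>\<close> depend, up to a constant, only on \<open>|A|\<close>, and in a
  doubling way. So \<open>\<phi>(m)\<close> may be computed along any convenient subsequence, and also on the
  differences of consecutive vectors of a coordinatewise convergent subsequence. These differences
  \<open>y\<^sub>n\<close> are semi-normalized and coordinatewise null, and we may assume that for each row \<open>i\<close> the
  \<open>\<ell>\<^sub>p\<close>-norms of the rows \<open>y\<^sub>n(i)\<close> converge to some \<open>c\<^sub>i\<close>. By a gliding hump argument a
  further subsequence consists, up to a summable error, of a part in the rows with \<open>c\<^sub>i > 0\<close>, whose
  summands have disjoint columns and give \<open>m\<^bsup>1/p\<^esup>\<close>, and of a part whose summands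
  have disjoint rows and give \<open>m\<^bsup>1/q\<^esup>\<close> or can be neglected. At least one of the two
  contributions is present, and the larger one determines \<open>r\<close>.\<close>

section \<open>The spaces \<open>\<ell>\<^sub>p\<close>\<close>

text \<open>Two obstacles shape the argument. When an exponent is \<infinity>, the coordinatewise
  limit of a bounded sequence may lie outside the space, so it cannot be subtracted; differences
  remove it, but m of them involve 2m vectors, hence the need for doubling. For small exponents
  there is only a quasi-triangle inequality, whose constant is paid at every addition; so errors
  must decay geometrically, and the main parts are controlled by disjointness of supports.

  The delicate bound is the upper one in the rows with c_i > 0: there may be infinitely many such
  rows, and they must be summed in \<ell>_q. Each chosen vector has row norms comparable with c_i in
  all the rows reached so far, so the last of m vectors dominates the others row by row, and its
  norm bounds the sum up to the factor m^{1/p}.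

  The disjoint rows obey a dichotomy. Either a fixed amount of norm escapes beyond every row for
  infinitely many n, and the vectors are chosen so that it always does; or the escaping part can be
  made as small as wished. Without this choice the sums need not follow a pure power of m.\<close>

lemma lp_infty_le:
  assumes "a \<in> lp_space \<infinity>" shows "norm (a n) \<le> lp_norm \<infinity> a"
proof -
  have "convergent a" using assms by (auto simp: lp_space_def convergent_def)
  then have "Bseq a" by (rule convergent_imp_Bseq)
  then have "bdd_above (range (\<lambda>n. norm (a n)))"
    by (auto simp: Bseq_def bdd_above_def)
  from cSUP_upper[OF UNIV_I this] show ?thesis by (simp add: lp_norm_def)
qed

lemma lp_norm_nonneg:
  assumes "a \<in> lp_space p" shows "0 \<le> lp_norm p a"
proof (cases "p = \<infinity>")
  case True
  then have "norm (a 0) \<le> lp_norm p a" using assms lp_infty_le by blast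
  then show ?thesis using norm_ge_zero order_trans by blast
qed (simp add: lp_norm_def)

lemma lp_norm_powr:
  assumes "a \<in> lp_space p" "0 < p" "p \<noteq> \<infinity>"
  shows "lp_norm p a powr enn2real p = (\<Sum>n. norm (a n) powr enn2real p)"
proof -
  have "0 < enn2real p" using assms by (simp add: enn2real_positive_iff top.not_eq_extremum)
  moreover have "0 \<le> (\<Sum>n. norm (a n) powr enn2real p)"
    using assms by (intro suminf_nonneg) (auto simp: lp_space_def)
  ultimately show ?thesis using assms by (simp add: lp_norm_def powr_powr)
qed

lemma lp_infty_norm_leI:
  assumes "\<And>n. norm (a n) \<le> b" "p = \<infinity>"
  shows "lp_norm p a \<le> b"
  using assms by (auto simp: lp_norm_def intro: cSUP_least)

lemma lp_norm_le:
  assumes "a \<in> lp_space p" "0 < p" shows "norm (a n) \<le> lp_norm p a"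
proof (cases "p = \<infinity>")
  case True
  then show ?thesis using assms lp_infty_le by blast
next
  case False
  have e: "0 < enn2real p" using False assms by (simp add: enn2real_positive_iff top.not_eq_extremum)
  have "norm (a n) powr enn2real p \<le> (\<Sum>n. norm (a n) powr enn2real p)"
    using assms False sum_le_suminf[of "\<lambda>n. norm (a n) powr enn2real p" "{n}"]
    by (auto simp: lp_space_def)
  also have "\<dots> = lp_norm p a powr enn2real p" using assms False lp_norm_powr by metis
  finally show ?thesis using e lp_norm_nonneg[OF assms(1)]
    by (metis linorder_not_le powr_less_mono2)
qed

text \<open>For finite p, replacing a sum of two norms by twice their maximum costs 2, and the root
  of a sum of two p-th powers costs 2^{1/p}; for p = \<infinity> the second factor is 2^0 = 1. The
  value is not optimal but treats exponents below and above 1 alike.\<close>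

definition lp_const :: "ennreal \<Rightarrow> real" where
  "lp_const p = 2 * 2 powr enn2real (1 / p)"

lemma lp_const_ge: "1 \<le> lp_const p"
proof -
  have "1 \<le> 2 powr enn2real (1 / p)" by (rule ge_one_powr_ge_zero) auto
  then show ?thesis by (simp add: lp_const_def)
qed

lemma enn2real_inverse_exponent:
  "0 < p \<Longrightarrow> p \<noteq> \<infinity> \<Longrightarrow> enn2real (1 / p) = 1 / enn2real p"
  by (cases p) (auto simp: divide_ennreal[of 1, simplified] ennreal_less_zero_iff)

text \<open>Pointwise domination with a factor, and with values in another space, makes this
  applicable to sequences of row norms; there \<open>L\<close> is the quasi-triangle constant of the
  inner space.\<close>

lemma lp_triangle:
  fixes a b :: "nat \<Rightarrow> 'a::real_normed_vector" and c :: "nat \<Rightarrow> 'b::real_normed_vector"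
  assumes "a \<in> lp_space p" "b \<in> lp_space p" "0 < p" "0 \<le> L"
    and le: "\<And>n. norm (c n) \<le> L * (norm (a n) + norm (b n))"
  shows "c \<in> lp_space p" "lp_norm p c \<le> L * lp_const p * (lp_norm p a + lp_norm p b)"
proof -
  have ab: "0 \<le> lp_norm p a" "0 \<le> lp_norm p b" using assms lp_norm_nonneg by blast+
  have "c \<in> lp_space p \<and> lp_norm p c \<le> L * lp_const p * (lp_norm p a + lp_norm p b)"
  proof (cases "p = \<infinity>")
    case True
    have "(\<lambda>n. L * (norm (a n) + norm (b n))) \<longlonglongrightarrow> L * (0 + 0)"
      using assms True by (intro tendsto_intros) (auto simp: lp_space_def tendsto_norm_zero_iff)
    then have "c \<longlonglongrightarrow> 0" 
      by (intro Lim_null_comparison[of c "\<lambda>n. L * (norm (a n) + norm (b n))"]) (use le in auto)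
    moreover have "lp_norm p c \<le> L * (lp_norm p a + lp_norm p b)"
    proof (rule lp_infty_norm_leI[OF _ True])
      fix n
      have "norm (c n) \<le> L * (norm (a n) + norm (b n))" by (rule le)
      also have "\<dots> \<le> L * (lp_norm p a + lp_norm p b)"
        using assms by (intro mult_left_mono add_mono lp_norm_le) auto
      finally show "norm (c n) \<le> L * (lp_norm p a + lp_norm p b)" .
    qed
    moreover have "L * (lp_norm p a + lp_norm p b) * 1 \<le> L * (lp_norm p a + lp_norm p b) * lp_const p"
      using lp_const_ge[of p] assms ab by (intro mult_left_mono) auto
    ultimately show ?thesis using True by (auto simp: lp_space_def mult_ac)
  next
    case False
    define e where "e = enn2real p"
    have e: "0 < e" using False assms by (simp add: e_def enn2real_positive_iff top.not_eq_extremum)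
    have sa: "summable (\<lambda>n. norm (a n) powr e)" "summable (\<lambda>n. norm (b n) powr e)"
      using assms False by (auto simp: lp_space_def e_def)
    have pt: "norm (c n) powr e \<le> (2 * L) powr e * (norm (a n) powr e + norm (b n) powr e)" for n
    proof -
      \<comment> \<open>The maximum avoids a case distinction between concave and convex
        powers.\<close>
      define M where "M = max (norm (a n)) (norm (b n))"
      have M: "norm (a n) \<le> M" "norm (b n) \<le> M" "0 \<le> M"
        by (simp_all add: M_def le_max_iff_disj)
      have "norm (c n) \<le> L * (norm (a n) + norm (b n))" by (rule le)
      also have "\<dots> \<le> L * (M + M)" using M assms by (intro mult_left_mono) auto
      finally have "norm (c n) \<le> (2 * L) * M" by simp
      then have "norm (c n) powr e \<le> ((2 * L) * M) powr e" using e by (intro powr_mono2) auto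
      also have "\<dots> = (2 * L) powr e * M powr e" using M assms by (simp add: powr_mult)
      also have "M powr e \<le> norm (a n) powr e + norm (b n) powr e"
        by (auto simp: M_def max_def)
      finally show ?thesis by (simp add: mult_left_mono)
    qed
    have sr: "summable (\<lambda>n. (2 * L) powr e * (norm (a n) powr e + norm (b n) powr e))"
      using sa by (intro summable_mult summable_add)
    have sc: "summable (\<lambda>n. norm (c n) powr e)"
      by (rule summable_comparison_test'[OF sr, of 0]) (use pt in auto)
    then have c: "c \<in> lp_space p" using False by (simp add: lp_space_def e_def)
    have "lp_norm p c powr e = (\<Sum>n. norm (c n) powr e)"
      using lp_norm_powr[OF c assms(3) False] by (simp add: e_def)
    also have "\<dots> \<le> (\<Sum>n. (2 * L) powr e * (norm (a n) powr e + norm (b n) powr e))"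
      by (rule suminf_le[OF pt sc sr])
    also have "\<dots> = (2 * L) powr e * (lp_norm p a powr e + lp_norm p b powr e)"
      using sa assms False by (simp add: suminf_mult summable_add suminf_add[symmetric] lp_norm_powr e_def)
    also have "\<dots> \<le> (2 * L) powr e * (2 * (lp_norm p a + lp_norm p b) powr e)"
    proof -
      have "lp_norm p a powr e \<le> (lp_norm p a + lp_norm p b) powr e"
           "lp_norm p b powr e \<le> (lp_norm p a + lp_norm p b) powr e"
        using ab e by (auto intro!: powr_mono2)
      then show ?thesis by (intro mult_left_mono) auto
    qed
    also have "\<dots> = (L * lp_const p * (lp_norm p a + lp_norm p b)) powr e"
    proof -
      have "enn2real (1 / p) = 1 / e"
        using enn2real_inverse_exponent[OF assms(3) False] by (simp add: e_def)
      then have two: "(2 powr enn2real (1 / p)) powr e = (2::real)" using e by (simp add: powr_powr)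
      have "(L * lp_const p * (lp_norm p a + lp_norm p b)) powr e
        = ((2 * L) * (2 powr enn2real (1 / p)) * (lp_norm p a + lp_norm p b)) powr e"
        by (simp add: lp_const_def mult_ac)
      also have "\<dots> = (2 * L) powr e * 2 * (lp_norm p a + lp_norm p b) powr e"
        using assms(4) ab by (subst powr_mult powr_mult[of "2 * L"], simp_all add: two powr_mult)+
      finally show ?thesis by simp
    qed
    finally have "lp_norm p c \<le> L * lp_const p * (lp_norm p a + lp_norm p b)"
      using e assms ab lp_const_ge[of p]
      by (smt (verit, best) mult_nonneg_nonneg powr_less_mono2)
    then show ?thesis using c by simp
  qed
  then show "c \<in> lp_space p" "lp_norm p c \<le> L * lp_const p * (lp_norm p a + lp_norm p b)" by auto
qed

text \<open>\<open>lp_triangle\<close> would lose the factor \<open>lp_const\<close>. The exact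
  constant is what makes restrictions contractive and the mixed norm homogeneous.\<close>

lemma lp_mono:
  fixes a :: "nat \<Rightarrow> 'a::real_normed_vector" and c :: "nat \<Rightarrow> 'b::real_normed_vector"
  assumes "a \<in> lp_space p" "0 < p" "0 \<le> L"
    and le: "\<And>n. norm (c n) \<le> L * norm (a n)"
  shows "c \<in> lp_space p" "lp_norm p c \<le> L * lp_norm p a"
proof -
  show c: "c \<in> lp_space p"
    by (rule lp_triangle(1)[OF assms(1,1-3)]) (use le assms(3) in \<open>smt (verit) mult_left_mono norm_ge_zero\<close>)
  show "lp_norm p c \<le> L * lp_norm p a"
  proof (cases "p = \<infinity>")
    case True
    show ?thesis
      by (rule lp_infty_norm_leI[OF _ True]) 
        (use le lp_norm_le[OF assms(1,2)] assms(3) in \<open>meson mult_left_mono order_trans\<close>)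
  next
    case False
    define e where "e = enn2real p"
    have e: "0 < e" using False assms by (simp add: e_def enn2real_positive_iff top.not_eq_extremum)
    have sa: "summable (\<lambda>n. norm (a n) powr e)" "summable (\<lambda>n. norm (c n) powr e)"
      using assms c False by (auto simp: lp_space_def e_def)
    have "lp_norm p c powr e = (\<Sum>n. norm (c n) powr e)"
      using lp_norm_powr[OF c assms(2) False] by (simp add: e_def)
    also have "\<dots> \<le> (\<Sum>n. L powr e * norm (a n) powr e)"
    proof (rule suminf_le)
      fix n
      show "norm (c n) powr e \<le> L powr e * norm (a n) powr e"
        using powr_mono2[OF _ _ le[of n], of e] e assms by (simp add: powr_mult)
    qed (use sa in \<open>auto intro: summable_mult\<close>)
    also have "\<dots> = L powr e * lp_norm p a powr e"
      using sa assms False by (simp add: suminf_mult lp_norm_powr e_def)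
    also have "\<dots> = (L * lp_norm p a) powr e" using assms lp_norm_nonneg by (simp add: powr_mult)
    finally show ?thesis using e assms lp_norm_nonneg[OF assms(1)]
      by (smt (verit, best) mult_nonneg_nonneg powr_less_mono2)
  qed
qed

text \<open>For p = \<infinity> this rests on the convention c_0: tails of a merely bounded sequence
  need not vanish.\<close>

lemma lp_tail_tendsto_0:
  assumes "a \<in> lp_space p" "0 < p"
  shows "(\<lambda>k. lp_norm p (\<lambda>n. if n < k then 0 else a n)) \<longlonglongrightarrow> 0"
proof (cases "p = \<infinity>")
  case True
  show ?thesis
  proof (rule LIMSEQ_I)
    fix r :: real assume "0 < r"
    then have "0 < r/2" by simp
    have "a \<longlonglongrightarrow> 0" using assms True by (simp add: lp_space_def)
    then obtain N where N: "\<And>n. n \<ge> N \<Longrightarrow> norm (a n) < r/2" 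
      using LIMSEQ_D[OF _ \<open>0 < r/2\<close>] by fastforce
    show "\<exists>N. \<forall>k\<ge>N. norm (lp_norm p (\<lambda>n. if n < k then 0 else a n) - 0) < r"
    proof (intro exI[of _ N] allI impI)
      fix k assume "k \<ge> N"
      have "lp_norm p (\<lambda>n. if n < k then 0 else a n) \<le> r/2"
        by (rule lp_infty_norm_leI[OF _ True]) (use N \<open>k \<ge> N\<close> \<open>0 < r\<close> in \<open>auto intro: less_imp_le\<close>)
      moreover have "0 \<le> lp_norm p (\<lambda>n. if n < k then 0 else a n)"
        by (rule lp_norm_nonneg, rule lp_mono(1)[OF assms, of 1]) auto
      ultimately show "norm (lp_norm p (\<lambda>n. if n < k then 0 else a n) - 0) < r" using \<open>0 < r\<close> by auto
    qed
  qed
next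
  case False
  define e where "e = enn2real p"
  have e: "0 < e" using False assms by (simp add: e_def enn2real_positive_iff top.not_eq_extremum)
  have sa: "summable (\<lambda>n. norm (a n) powr e)" using assms False by (simp add: lp_space_def e_def)
  have "(\<Sum>n. norm (if n < k then 0 else a n) powr e) = (\<Sum>n. norm (a (n + k)) powr e)" for k
  proof -
    have "summable (\<lambda>n. norm (if n < k then 0 else a n) powr e)"
      by (rule summable_comparison_test'[OF sa, of 0]) auto
    from suminf_split_initial_segment[OF this, of k] show ?thesis by simp
  qed
  then have "lp_norm p (\<lambda>n. if n < k then 0 else a n) = (\<Sum>n. norm (a (n + k)) powr e) powr (1/e)" for k
    using False by (simp add: lp_norm_def e_def)
  moreover have "(\<lambda>k. (\<Sum>n. norm (a (n + k)) powr e) powr (1/e)) \<longlonglongrightarrow> 0 powr (1/e)"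
    by (rule tendsto_powr2[OF suminf_exist_split2[OF sa] tendsto_const])
      (use e in \<open>auto intro!: always_eventually suminf_nonneg summable_ignore_initial_segment[OF sa]\<close>)
  ultimately show ?thesis by simp
qed

section \<open>Sums of disjointly supported sequences\<close>

text \<open>Powers, norms and row norms are not additive, but they pass through a sum in which at
  most one term is active.\<close>

lemma sum_at_most_one_nonzero:
  fixes x :: "'i \<Rightarrow> 'a::comm_monoid_add" and h :: "'a \<Rightarrow> 'b::comm_monoid_add"
  assumes "finite S" "\<And>j k. j \<in> S \<Longrightarrow> k \<in> S \<Longrightarrow> x j \<noteq> 0 \<Longrightarrow> x k \<noteq> 0 \<Longrightarrow> j = k" "h 0 = 0"
  shows "h (\<Sum>k\<in>S. x k) = (\<Sum>k\<in>S. h (x k))"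
proof (cases "\<exists>j\<in>S. x j \<noteq> 0")
  case True
  then obtain j where j: "j \<in> S" "x j \<noteq> 0" by blast
  then have "x k = 0" if "k \<in> S - {j}" for k using assms(2) that by blast
  then show ?thesis using j assms by (simp add: sum.remove[OF assms(1) j(1)])
qed (use assms in simp)

text \<open>Each position sees at most one summand, so p-th powers add up exactly. As
  \<open>s\<close> is only dominated and may take values elsewhere, the lemma serves both for
  columns inside one row and, through the row norms, for disjoint rows.\<close>

lemma lp_disjoint_upper:
  fixes a :: "nat \<Rightarrow> nat \<Rightarrow> 'a::real_normed_vector" and s :: "nat \<Rightarrow> 'b::real_normed_vector"
  assumes "0 < p" "m \<ge> 1" and a: "\<And>k. k < m \<Longrightarrow> a k \<in> lp_space p"
    and disj: "\<And>n j k. j < m \<Longrightarrow> k < m \<Longrightarrow> a j n \<noteq> 0 \<Longrightarrow> a k n \<noteq> 0 \<Longrightarrow> j = k"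
    and s: "\<And>n. norm (s n) \<le> (\<Sum>k<m. norm (a k n))"
    and b: "\<And>k. k < m \<Longrightarrow> lp_norm p (a k) \<le> b"
  shows "lp_norm p s \<le> real m powr enn2real (1 / p) * b"
proof (cases "p = \<infinity>")
  case True
  have "norm (s n) \<le> b" for n
  proof (cases "\<exists>j<m. a j n \<noteq> 0")
    case True
    then obtain j where j: "j < m" "a j n \<noteq> 0" by blast
    have "a k n = 0" if "k \<in> {..<m} - {j}" for k using disj[of k j n] j that by auto
    then have "(\<Sum>k\<in>{..<m} - {j}. norm (a k n)) = 0" by simp
    then have "(\<Sum>k<m. norm (a k n)) = norm (a j n)"
      using sum.remove[of "{..<m}" j "\<lambda>k. norm (a k n)"] j by simp
    then show ?thesis using s[of n] lp_norm_le[OF a[OF j(1)] assms(1), of n] b[OF j(1)] by linarith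
  next
    case False
    then have "norm (s n) \<le> 0" using s[of n] by simp
    also have "0 \<le> b" using b[of 0] lp_norm_nonneg[OF a[of 0]] assms(2) by fastforce
    finally show ?thesis .
  qed
  then have "lp_norm p s \<le> b" by (rule lp_infty_norm_leI[OF _ True])
  then show ?thesis using True assms by simp
next
  case False
  define e where "e = enn2real p"
  have e: "0 < e" using False assms by (simp add: e_def enn2real_positive_iff top.not_eq_extremum)
  have b0: "0 \<le> b" using b[of 0] lp_norm_nonneg[OF a[of 0]] assms(2) by fastforce
  have sa: "summable (\<lambda>n. norm (a k n) powr e)" if "k < m" for k
    using a[OF that] False by (simp add: lp_space_def e_def)
  then have ss: "summable (\<lambda>n. \<Sum>k<m. norm (a k n) powr e)" by (intro summable_sum) auto
  have pt: "norm (s n) powr e \<le> (\<Sum>k<m. norm (a k n) powr e)" for n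
  proof -
    have "norm (s n) powr e \<le> (\<Sum>k<m. norm (a k n)) powr e" using s e by (intro powr_mono2) auto
    also have "\<dots> = (\<Sum>k<m. norm (a k n) powr e)"
      by (rule sum_at_most_one_nonzero[where h = "\<lambda>x. x powr e"]) (use disj in auto)
    finally show ?thesis .
  qed
  have sl: "summable (\<lambda>n. norm (s n) powr e)"
    by (rule summable_comparison_test'[OF ss, of 0]) (use pt in auto)
  then have "s \<in> lp_space p" using False by (simp add: lp_space_def e_def)
  then have "lp_norm p s powr e = (\<Sum>n. norm (s n) powr e)"
    using lp_norm_powr assms False by (simp add: e_def)
  also have "\<dots> \<le> (\<Sum>n. \<Sum>k<m. norm (a k n) powr e)" by (rule suminf_le[OF pt sl ss])
  also have "\<dots> = (\<Sum>k<m. lp_norm p (a k) powr e)"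
    using sa suminf_sum[of "{..<m}" "\<lambda>k n. norm (a k n) powr e"]
      lp_norm_powr[OF a assms(1) False] by (simp add: e_def)
  also have "\<dots> \<le> (\<Sum>k<m. b powr e)"
    using b e lp_norm_nonneg[OF a] by (intro sum_mono powr_mono2) auto
  also have "\<dots> = (real m powr enn2real (1 / p) * b) powr e"
    using e b0 enn2real_inverse_exponent[OF assms(1) False] by (simp add: powr_mult powr_powr e_def)
  finally show ?thesis using e b0
    by (metis linorder_not_le mult_nonneg_nonneg powr_ge_zero powr_less_mono2)
qed

lemma lp_disjoint_lower:
  fixes a :: "nat \<Rightarrow> nat \<Rightarrow> 'a::real_normed_vector" and s :: "nat \<Rightarrow> 'b::real_normed_vector"
  assumes "0 < p" "m \<ge> 1" "0 \<le> b" "s \<in> lp_space p" and a: "\<And>k. k < m \<Longrightarrow> a k \<in> lp_space p"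
    and disj: "\<And>n j k. j < m \<Longrightarrow> k < m \<Longrightarrow> a j n \<noteq> 0 \<Longrightarrow> a k n \<noteq> 0 \<Longrightarrow> j = k"
    and s: "\<And>n. (\<Sum>k<m. norm (a k n)) \<le> norm (s n)"
    and b: "\<And>k. k < m \<Longrightarrow> b \<le> lp_norm p (a k)"
  shows "real m powr enn2real (1 / p) * b \<le> lp_norm p s"
proof (cases "p = \<infinity>")
  case True
  \<comment> \<open>Since m^{1/\<infinity>} = 1, a single summand already gives the bound.\<close>
  have "norm (a 0 n) \<le> 1 * norm (s n)" for n
  proof -
    have "norm (a 0 n) \<le> (\<Sum>k<m. norm (a k n))" using assms(2) by (intro member_le_sum) auto
    then show ?thesis using s[of n] by simp
  qed
  then have "lp_norm p (a 0) \<le> 1 * lp_norm p s" by (intro lp_mono(2)[OF assms(4,1)]) auto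
  then show ?thesis using True assms(2) b[of 0] by simp
next
  case False
  define e where "e = enn2real p"
  have e: "0 < e" using False assms by (simp add: e_def enn2real_positive_iff top.not_eq_extremum)
  have sa: "summable (\<lambda>n. norm (a k n) powr e)" if "k < m" for k
    using a[OF that] False by (simp add: lp_space_def e_def)
  then have ss: "summable (\<lambda>n. \<Sum>k<m. norm (a k n) powr e)" by (intro summable_sum) auto
  have pt: "(\<Sum>k<m. norm (a k n) powr e) \<le> norm (s n) powr e" for n
  proof -
    have "(\<Sum>k<m. norm (a k n) powr e) = (\<Sum>k<m. norm (a k n)) powr e"
      by (rule sum_at_most_one_nonzero[where h = "\<lambda>x. x powr e", symmetric]) (use disj in auto)
    also have "\<dots> \<le> norm (s n) powr e" using s e by (intro powr_mono2) (auto intro: sum_nonneg)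
    finally show ?thesis .
  qed
  have sl: "summable (\<lambda>n. norm (s n) powr e)" using assms(4) False by (simp add: lp_space_def e_def)
  have "(real m powr enn2real (1 / p) * b) powr e = (\<Sum>k<m. b powr e)"
    using e assms(3) enn2real_inverse_exponent[OF assms(1) False] by (simp add: powr_mult powr_powr e_def)
  also have "\<dots> \<le> (\<Sum>k<m. lp_norm p (a k) powr e)"
    using b e assms(3) by (intro sum_mono powr_mono2) auto
  also have "\<dots> = (\<Sum>n. \<Sum>k<m. norm (a k n) powr e)" 
    using sa suminf_sum[of "{..<m}" "\<lambda>k n. norm (a k n) powr e"]
      lp_norm_powr[OF a assms(1) False] by (simp add: e_def)
  also have "\<dots> \<le> (\<Sum>n. norm (s n) powr e)" by (rule suminf_le[OF pt ss sl])
  also have "\<dots> = lp_norm p s powr e"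
    using lp_norm_powr[OF assms(4,1) False] by (simp add: e_def)
  finally show ?thesis using e lp_norm_nonneg[OF assms(4)]
    by (metis linorder_not_le powr_less_mono2)
qed

section \<open>Mixed-norm spaces\<close>

lemma mixed_memD:
  assumes "f \<in> mixed_space p q"
  shows "f i \<in> lp_space p" "(\<lambda>i. lp_norm p (f i)) \<in> lp_space q"
  using assms by (auto simp: mixed_space_def)

lemma mixed_norm_nonneg: "f \<in> mixed_space p q \<Longrightarrow> 0 \<le> mixed_norm p q f"
  by (simp add: mixed_norm_def mixed_space_def lp_norm_nonneg)

lemma row_norm_le:
  assumes "f \<in> mixed_space p q" "0 < q"
  shows "lp_norm p (f i) \<le> mixed_norm p q f"
  using lp_norm_le[OF mixed_memD(2)[OF assms(1)] assms(2), of i]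
    lp_norm_nonneg[OF mixed_memD(1)[OF assms(1)], of i] by (simp add: mixed_norm_def)

lemma entry_norm_le:
  assumes "f \<in> mixed_space p q" "0 < p" "0 < q"
  shows "norm (f i j) \<le> mixed_norm p q f"
  using lp_norm_le[OF mixed_memD(1)[OF assms(1)] assms(2)] row_norm_le[OF assms(1,3)] order_trans by blast

text \<open>The inner constant is paid in each row, the outer one when the row norms are
  combined.\<close>

definition mixed_const :: "ennreal \<Rightarrow> ennreal \<Rightarrow> real" where
  "mixed_const p q = lp_const p * lp_const q"

lemma mixed_const_ge: "1 \<le> mixed_const p q"
  using mult_mono[OF lp_const_ge[of p] lp_const_ge[of q]] lp_const_ge[of p] by (simp add: mixed_const_def)

text \<open>Domination replaces the equation h = f + g because \<open>h\<close> will also be a piece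
  of a sum or difference, such as its entries in a given set.\<close>

lemma mixed_triangle_le:
  fixes f g :: "nat \<Rightarrow> nat \<Rightarrow> 'a::real_normed_field"
  assumes f: "f \<in> mixed_space p q" and g: "g \<in> mixed_space p q" and p: "0 < p" "0 < q"
    and le: "\<And>i j. norm (h i j) \<le> norm (f i j) + norm (g i j)"
  shows "h \<in> mixed_space p q"
    "mixed_norm p q h \<le> mixed_const p q * (mixed_norm p q f + mixed_norm p q g)"
proof -
  note fD = mixed_memD[OF f] and gD = mixed_memD[OF g]
  have row: "h i \<in> lp_space p" 
      "lp_norm p (h i) \<le> lp_const p * (lp_norm p (f i) + lp_norm p (g i))" for i
    using lp_triangle[OF fD(1)[of i] gD(1)[of i] p(1), of 1 "h i"] le[of i] by auto
  have "norm (lp_norm p (h i)) \<le> lp_const p * (norm (lp_norm p (f i)) + norm (lp_norm p (g i)))" for i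
    using row(2)[of i] lp_norm_nonneg[OF row(1)] lp_norm_nonneg[OF fD(1)] lp_norm_nonneg[OF gD(1)]
    by simp
  from lp_triangle[OF fD(2) gD(2) p(2) _ this] lp_const_ge[of p] row(1)
  show "h \<in> mixed_space p q"
    "mixed_norm p q h \<le> mixed_const p q * (mixed_norm p q f + mixed_norm p q g)"
    by (auto simp: mixed_space_def mixed_norm_def mixed_const_def)
qed

lemma mixed_mono:
  assumes f: "f \<in> mixed_space p q" and p: "0 < p" "0 < q" "0 \<le> L"
    and le: "\<And>i j. norm (g i j) \<le> L * norm (f i j)"
  shows "g \<in> mixed_space p q" "mixed_norm p q g \<le> L * mixed_norm p q f"
proof -
  note fD = mixed_memD[OF f]
  have row: "g i \<in> lp_space p" "lp_norm p (g i) \<le> L * lp_norm p (f i)" for i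
    using lp_mono[OF fD(1) p(1,3) le] by auto
  have "norm (lp_norm p (g i)) \<le> L * norm (lp_norm p (f i))" for i
    using row(2)[of i] lp_norm_nonneg[OF row(1)] lp_norm_nonneg[OF fD(1)] by simp
  from lp_mono[OF fD(2) p(2,3) this] row(1)
  show "g \<in> mixed_space p q" "mixed_norm p q g \<le> L * mixed_norm p q f"
    by (auto simp: mixed_space_def mixed_norm_def)
qed

lemma mixed_norm_scale:
  assumes f: "f \<in> mixed_space p q" and p: "0 < p" "0 < q"
  shows "mixed_scale c f \<in> mixed_space p q"
    "mixed_norm p q (mixed_scale c f) = norm c * mixed_norm p q f"
proof -
  show V: "mixed_scale c f \<in> mixed_space p q"
    by (rule mixed_mono(1)[OF f p, of "norm c"]) (auto simp: mixed_scale_def seq_scale_def norm_mult)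
  have 1: "mixed_norm p q (mixed_scale c f) \<le> norm c * mixed_norm p q f"
    by (rule mixed_mono(2)[OF f p]) (auto simp: mixed_scale_def seq_scale_def norm_mult)
  show "mixed_norm p q (mixed_scale c f) = norm c * mixed_norm p q f"
  proof (cases "c = 0")
    case True
    then show ?thesis using 1 mixed_norm_nonneg[OF V] by simp
  next
    case False
    have "mixed_norm p q f \<le> (1 / norm c) * mixed_norm p q (mixed_scale c f)"
      by (rule mixed_mono(2)[OF V p])
        (use False in \<open>auto simp: mixed_scale_def seq_scale_def norm_mult\<close>)
    then show ?thesis using 1 False by (simp add: field_simps)
  qed
qed

lemma lp_zero: "(\<lambda>n. 0) \<in> lp_space p" "lp_norm p (\<lambda>n. 0) = 0"
  by (auto simp: lp_space_def lp_norm_def)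

lemma mixed_zero: "0 \<in> mixed_space p q" "mixed_norm p q 0 = 0"
  by (auto simp: mixed_space_def mixed_norm_def func_zero lp_zero)

lemma mixed_add:
  assumes "f \<in> mixed_space p q" "g \<in> mixed_space p q" "0 < p" "0 < q"
  shows "f + g \<in> mixed_space p q"
    "mixed_norm p q (f + g) \<le> mixed_const p q * (mixed_norm p q f + mixed_norm p q g)"
  by (rule mixed_triangle_le[OF assms]; simp add: norm_triangle_ineq)+

lemma mixed_diff:
  assumes "f \<in> mixed_space p q" "g \<in> mixed_space p q" "0 < p" "0 < q"
  shows "f - g \<in> mixed_space p q"
    "mixed_norm p q (f - g) \<le> mixed_const p q * (mixed_norm p q f + mixed_norm p q g)"
  by (rule mixed_triangle_le[OF assms]; simp add: norm_triangle_ineq4)+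

lemma mixed_sum_in:
  assumes "0 < p" "0 < q" "\<And>k. k \<in> S \<Longrightarrow> f k \<in> mixed_space p q"
  shows "(\<Sum>k\<in>S. f k) \<in> mixed_space p q"
  using assms(3)
  by (induction S rule: infinite_finite_induct) (auto simp: mixed_zero assms mixed_add)

text \<open>The bound must not depend on \<open>m\<close>. The induction runs downwards over the
  tails starting at \<open>j\<close>: one addition costs K, and K times twice \<delta> / (2K)^{j+1}
  is exactly \<delta> / (2K)^j.\<close>

lemma mixed_sum_small:
  assumes p: "0 < p" "0 < q" and f: "\<And>k. k < m \<Longrightarrow> f k \<in> mixed_space p q"
    "\<And>k. k < m \<Longrightarrow> mixed_norm p q (f k) \<le> \<delta> / (2 * mixed_const p q) ^ Suc k" and "0 \<le> \<delta>"
  shows "mixed_norm p q (\<Sum>k<m. f k) \<le> \<delta>"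
proof -
  define K where "K = mixed_const p q"
  have K: "K \<ge> 1" using mixed_const_ge by (simp add: K_def)
  have "mixed_norm p q (\<Sum>k=j..<m. f k) \<le> \<delta> / (2 * K) ^ j" if "j \<le> m" for j
    using that
  proof (induction j rule: inc_induct)
    case base
    have "(\<Sum>k=m..<m. f k) = 0" by simp
    then have eq: "mixed_norm p q (\<Sum>k=m..<m. f k) = 0" by (simp only: mixed_zero)
    show ?case unfolding eq using assms K by simp
  next
    case (step j)
    have "mixed_norm p q (f j + (\<Sum>k=Suc j..<m. f k))
        \<le> K * (mixed_norm p q (f j) + mixed_norm p q (\<Sum>k=Suc j..<m. f k))"
      unfolding K_def by (rule mixed_add(2)) (use step p f in \<open>auto intro: mixed_sum_in\<close>)
    also have "\<dots> \<le> K * (\<delta> / (2 * K) ^ Suc j + \<delta> / (2 * K) ^ Suc j)"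
      using K step f(2)[of j] by (intro mult_left_mono add_mono) (auto simp: K_def)
    also have "\<dots> = \<delta> / (2 * K) ^ j" using K by (simp add: field_simps)
    finally show ?case unfolding sum.atLeast_Suc_lessThan[OF \<open>j < m\<close>] .
  qed
  from this[of 0] show ?thesis by (simp add: lessThan_atLeast0)
qed

lemma sum_apply_apply: "(\<Sum>k\<in>S. f k) i j = (\<Sum>k\<in>S. f k i j)"
  by (induction S rule: infinite_finite_induct) auto

section \<open>Restrictions to sets of entries\<close>

definition restrict_to :: "(nat \<times> nat) set \<Rightarrow> (nat \<Rightarrow> nat \<Rightarrow> 'a::zero) \<Rightarrow> nat \<Rightarrow> nat \<Rightarrow> 'a" where
  "restrict_to S f = (\<lambda>i j. if (i, j) \<in> S then f i j else 0)"

lemma restrict_to_in: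
  assumes "f \<in> mixed_space p q" "0 < p" "0 < q"
  shows "restrict_to S f \<in> mixed_space p q"
  by (rule mixed_mono(1)[OF assms, of 1]) (auto simp: restrict_to_def)

lemma restrict_to_mono:
  assumes "f \<in> mixed_space p q" "0 < p" "0 < q" "S \<subseteq> T"
  shows "mixed_norm p q (restrict_to S f) \<le> mixed_norm p q (restrict_to T f)"
proof -
  have "mixed_norm p q (restrict_to S f) \<le> 1 * mixed_norm p q (restrict_to T f)"
    by (rule mixed_mono(2)[OF restrict_to_in[OF assms(1-3)] assms(2,3)]) (use assms(4) in \<open>auto simp: restrict_to_def\<close>)
  then show ?thesis by simp
qed

lemma restrict_to_UNIV: "restrict_to UNIV f = f" by (simp add: restrict_to_def)

lemma restrict_to_le:
  assumes "f \<in> mixed_space p q" "0 < p" "0 < q"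
  shows "mixed_norm p q (restrict_to S f) \<le> mixed_norm p q f"
  using restrict_to_mono[OF assms, of S UNIV] by (simp add: restrict_to_UNIV)

lemma restrict_to_union:
  assumes "f \<in> mixed_space p q" "0 < p" "0 < q"
  shows "mixed_norm p q (restrict_to (S \<union> T) f)
    \<le> mixed_const p q * (mixed_norm p q (restrict_to S f) + mixed_norm p q (restrict_to T f))"
  by (rule mixed_triangle_le(2)) (use assms restrict_to_in[OF assms] in \<open>auto simp: restrict_to_def\<close>)

lemma restrict_to_union_tendsto_0:
  assumes f: "\<And>n. f n \<in> mixed_space p q" and p: "0 < p" "0 < q"
    and S: "(\<lambda>n. mixed_norm p q (restrict_to (S n) (f n))) \<longlonglongrightarrow> 0"
    and T: "(\<lambda>n. mixed_norm p q (restrict_to (T n) (f n))) \<longlonglongrightarrow> 0"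
  shows "(\<lambda>n. mixed_norm p q (restrict_to (S n \<union> T n) (f n))) \<longlonglongrightarrow> 0"
proof (rule tendsto_sandwich[OF _ _ tendsto_const])
  show "(\<lambda>n. mixed_const p q * (mixed_norm p q (restrict_to (S n) (f n)) + mixed_norm p q (restrict_to (T n) (f n))))
      \<longlonglongrightarrow> 0"
    by (rule tendsto_eq_intros S T refl | simp)+
qed (use restrict_to_union[OF f p] mixed_norm_nonneg[OF restrict_to_in[OF f p]] in auto)

lemma restrict_to_Union_tendsto_0:
  assumes f: "\<And>n. f n \<in> mixed_space p q" and p: "0 < p" "0 < q" and "finite I"
    and S: "\<And>i. i \<in> I \<Longrightarrow> (\<lambda>n. mixed_norm p q (restrict_to (S i n) (f n))) \<longlonglongrightarrow> 0"
  shows "(\<lambda>n. mixed_norm p q (restrict_to (\<Union>i\<in>I. S i n) (f n))) \<longlonglongrightarrow> 0"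
  using \<open>finite I\<close> S
proof (induction I)
  case empty
  have "mixed_norm p q (restrict_to {} (f n)) \<le> 0 * mixed_norm p q (f n)" for n
    by (rule mixed_mono(2)[OF f p]) (auto simp: restrict_to_def)
  then have "mixed_norm p q (restrict_to {} (f n)) = 0" for n
    using mixed_norm_nonneg[OF restrict_to_in[OF f p], of "{}" n] by (simp add: order_antisym)
  then show ?case by simp
next
  case (insert i I)
  then show ?case using restrict_to_union_tendsto_0[OF f p, where S = "S i" and T = "\<lambda>n. \<Union>i\<in>I. S i n"] by simp
qed

lemma lp_norm_single:
  assumes "0 < p" "\<And>n. n \<noteq> i \<Longrightarrow> a n = 0"
  shows "lp_norm p a = norm (a i)"
proof (cases "p = \<infinity>")
  case True
  have "(SUP n. norm (a n)) = norm (a i)"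
  proof (rule cSup_eq_maximum)
    show "x \<le> norm (a i)" if x: "x \<in> range (\<lambda>n. norm (a n))" for x
    proof -
      obtain n where "x = norm (a n)" using x by blast
      then show ?thesis using assms(2)[of n] by (cases "n = i") auto
    qed
  qed auto
  then show ?thesis using True by (simp add: lp_norm_def)
next
  case False
  have e: "0 < enn2real p" using False assms by (simp add: enn2real_positive_iff top.not_eq_extremum)
  have "(\<Sum>n. norm (a n) powr enn2real p) = norm (a i) powr enn2real p"
    using suminf_finite[of "{i}" "\<lambda>n. norm (a n) powr enn2real p"] assms(2) by auto
  then show ?thesis using False e by (simp add: lp_norm_def powr_powr)
qed

text \<open>\<open>f\<close> is arbitrary here, so the sign of the row functional is not known;
  hence the absolute value.\<close>

lemma mixed_norm_restrict_to_row:
  assumes "0 < p" "0 < q"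
  shows "mixed_norm p q (restrict_to ({i} \<times> J) f) = \<bar>lp_norm p (\<lambda>j. if j \<in> J then f i j else 0)\<bar>"
proof -
  have "lp_norm p (\<lambda>j. if k = i \<and> j \<in> J then f k j else 0) = 0" if "k \<noteq> i" for k
    using that by (simp add: lp_norm_def)
  then show ?thesis
    unfolding mixed_norm_def restrict_to_def
    by (subst lp_norm_single[OF assms(2), of i]) auto
qed

text \<open>Every vector is nearly supported in a finite square: cut off the rows far out, then the
  columns far out in the finitely many remaining rows. This is what ends the k-th hump.\<close>

lemma restrict_to_corner_complement_tendsto_0:
  assumes f: "f \<in> mixed_space p q" and p: "0 < p" "0 < q"
  shows "(\<lambda>k. mixed_norm p q (restrict_to (- ({..<k} \<times> {..<k})) f)) \<longlonglongrightarrow> 0"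
proof -
  have rows: "(\<lambda>k. mixed_norm p q (restrict_to ({k..} \<times> UNIV) f)) \<longlonglongrightarrow> 0"
  proof -
    have "lp_norm p (restrict_to ({k..} \<times> UNIV) f i) = (if i < k then 0 else lp_norm p (f i))" for i k
      by (auto simp: restrict_to_def lp_norm_def)
    then have "mixed_norm p q (restrict_to ({k..} \<times> UNIV) f)
        = lp_norm q (\<lambda>i. if i < k then 0 else lp_norm p (f i))" for k
      by (simp add: mixed_norm_def)
    then show ?thesis using lp_tail_tendsto_0[OF mixed_memD(2)[OF f] p(2)] by simp
  qed
  have cols: "(\<lambda>k. mixed_norm p q (restrict_to ({i} \<times> {k..}) f)) \<longlonglongrightarrow> 0" for i
  proof -
    have "(\<lambda>k. lp_norm p (\<lambda>j. if j < k then 0 else f i j)) \<longlonglongrightarrow> 0"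
      by (rule lp_tail_tendsto_0[OF mixed_memD(1)[OF f] p(1)])
    moreover have "(\<lambda>j. if j \<in> {k..} then f i j else 0) = (\<lambda>j. if j < k then 0 else f i j)" for k
      by auto
    ultimately show ?thesis
      unfolding mixed_norm_restrict_to_row[OF p] by (simp add: tendsto_rabs_zero)
  qed
  show ?thesis
  proof (rule LIMSEQ_I)
    fix r :: real assume r: "0 < r"
    define K where "K = mixed_const p q"
    have K: "K \<ge> 1" using mixed_const_ge by (simp add: K_def)
    then have r': "0 < r / (2 * K)" using r by simp
    obtain M where M: "mixed_norm p q (restrict_to ({M..} \<times> UNIV) f) < r / (2 * K)"
      using order_tendstoD(2)[OF rows r'] unfolding eventually_sequentially by blast
    \<comment> \<open>\<open>M\<close> is fixed before \<open>L\<close>, because the column tails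
      vanish only row by row and not uniformly in the rows.\<close>
    have "(\<lambda>k. mixed_norm p q (restrict_to (\<Union>i\<in>{..<M}. {i} \<times> {k..}) f)) \<longlonglongrightarrow> 0"
      by (rule restrict_to_Union_tendsto_0[OF f p _ cols]) auto
    from order_tendstoD(2)[OF this r'] obtain L where L: "\<And>k. k \<ge> L \<Longrightarrow> mixed_norm p q (restrict_to (\<Union>i\<in>{..<M}. {i} \<times> {k..}) f) < r / (2 * K)"
      unfolding eventually_sequentially by blast
    show "\<exists>no. \<forall>k\<ge>no. norm (mixed_norm p q (restrict_to (- ({..<k} \<times> {..<k})) f) - 0) < r"
    proof (intro exI[of _ "max M L"] allI impI)
      fix k assume k: "max M L \<le> k"
      have "mixed_norm p q (restrict_to (- ({..<k} \<times> {..<k})) f)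
        \<le> mixed_norm p q (restrict_to (({M..} \<times> UNIV) \<union> (\<Union>i\<in>{..<M}. {i} \<times> {k..})) f)"
        by (rule restrict_to_mono[OF f p]) (use k in auto)
      also have "\<dots> \<le> K * (mixed_norm p q (restrict_to ({M..} \<times> UNIV) f)
           + mixed_norm p q (restrict_to (\<Union>i\<in>{..<M}. {i} \<times> {k..}) f))"
        unfolding K_def by (rule restrict_to_union[OF f p])
      also have "\<dots> < K * (r / (2 * K) + r / (2 * K))"
        using M L[of k] k K by (intro mult_strict_left_mono add_strict_mono) auto
      also have "\<dots> = r" using K by (simp add: field_simps)
      finally show "norm (mixed_norm p q (restrict_to (- ({..<k} \<times> {..<k})) f) - 0) < r"
        using mixed_norm_nonneg[OF restrict_to_in[OF f p]] by simp
    qed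
  qed
qed

section \<open>Symmetric sequence spaces\<close>

text \<open>Symmetry is stated for permutations of all of N, so the finite bijection has to be
  extended; both complements are infinite and can be enumerated against each other.\<close>

lemma ex_bij_image_lessThan:
  fixes A :: "nat set"
  assumes "finite A"
  shows "\<exists>\<pi>. bij \<pi> \<and> bij_betw \<pi> {..<card A} A"
proof -
  obtain f where f: "bij_betw f {..<card A} A"
    using ex_bij_betw_nat_finite[OF assms] by (auto simp: lessThan_atLeast0)
  have "bij_betw (enumerate (- A)) UNIV (- A)" 
    using assms by (intro bij_enumerate) (simp add: Compl_eq_Diff_UNIV)
  moreover have "bij_betw (inv_into UNIV (enumerate (- {..<card A}))) (- {..<card A}) UNIV"
    by (intro bij_betw_inv_into bij_enumerate) (simp add: Compl_eq_Diff_UNIV)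
  ultimately obtain g where g: "bij_betw g (- {..<card A}) (- A)"
    using bij_betw_trans by blast
  let ?\<pi> = "\<lambda>n. if n \<in> {..<card A} then f n else g n"
  have "bij_betw ?\<pi> ({..<card A} \<union> - {..<card A}) (A \<union> - A)"
    by (rule bij_betw_disjoint_Un[OF f g]) auto
  then have "bij ?\<pi>" by (simp only: Compl_partition)
  moreover have "bij_betw ?\<pi> {..<card A} A"
    using f bij_betw_cong[of "{..<card A}" ?\<pi> f A] by simp
  ultimately show ?thesis by (intro exI[of _ ?\<pi>] conjI)
qed

text \<open>Common ground of the symmetric spaces and of Z_{p,q}, with the quasi-triangle constant
  made explicit because the estimates multiply it up.\<close>

locale quasi_normed_space = vector_space scl
  for scl :: "'a::real_normed_field \<Rightarrow> 'b::ab_group_add \<Rightarrow> 'b" +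
  fixes V :: "'b set" and N :: "'b \<Rightarrow> real" and K :: real
  assumes subspace_carrier: "subspace V"
    and qnorm_nonneg: "f \<in> V \<Longrightarrow> 0 \<le> N f"
    and qnorm_eq_0: "f \<in> V \<Longrightarrow> N f = 0 \<Longrightarrow> f = 0"
    and qnorm_scale: "f \<in> V \<Longrightarrow> N (scl c f) = norm c * N f"
    and const_ge: "1 \<le> K"
    and qnorm_triangle: "f \<in> V \<Longrightarrow> g \<in> V \<Longrightarrow> N (f + g) \<le> K * (N f + N g)"
begin

lemma qnorm_zero: "N 0 = 0"
  using qnorm_scale[OF subspace_0[OF subspace_carrier], of 0] by simp

text \<open>A quasi-norm need not be continuous, but here the quasi-norms of the remainders are
  eventually constant, so their limit 0 is attained. This identifies the abstract sums in the
  definitions with finite sums.\<close>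

lemma qnorm_sums_eventually_const:
  assumes "qnorm_sums N u f" "f \<in> V" "s \<in> V" "\<And>M. M \<ge> m \<Longrightarrow> (\<Sum>n<M. u n) = s"
  shows "f = s"
proof -
  have "eventually (\<lambda>M. N ((\<Sum>n<M. u n) - f) = N (s - f)) sequentially"
    using assms(4) by (intro eventually_sequentiallyI[of m]) simp
  then have "(\<lambda>M. N ((\<Sum>n<M. u n) - f)) \<longlonglongrightarrow> N (s - f)"
    by (simp add: tendsto_eventually)
  then have "N (s - f) = 0" using assms(1) LIMSEQ_unique by (auto simp: qnorm_sums_def)
  then show ?thesis using qnorm_eq_0[OF subspace_diff[OF subspace_carrier assms(3,2)]] by simp
qed

end

lemma quasi_banach_imp_quasi_normed:
  assumes "quasi_banach_space scl V N"
  shows "\<exists>K. quasi_normed_space scl V N K"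
proof -
  interpret quasi_banach_space scl V N by fact
  obtain K where K: "\<And>f g. f \<in> V \<Longrightarrow> g \<in> V \<Longrightarrow> N (f + g) \<le> K * (N f + N g)"
    using qnorm_quasi_triangle by blast
  have "quasi_normed_space scl V N (max K 1)"
  proof unfold_locales
    fix f g assume fg: "f \<in> V" "g \<in> V"
    have "N (f + g) \<le> K * (N f + N g)" using K fg .
    also have "\<dots> \<le> max K 1 * (N f + N g)" using fg qnorm_nonneg by (intro mult_right_mono) auto
    finally show "N (f + g) \<le> max K 1 * (N f + N g)" .
  qed (use subspace_carrier qnorm_nonneg qnorm_eq_0_iff qnorm_scale in auto)
  then show ?thesis ..
qed

text \<open>The symmetry condition is applied to the indicator of an initial segment, with a
  permutation that carries the segment onto \<open>A\<close>.\<close>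

lemma symmetric_norm_signs:
  fixes S :: "(nat \<Rightarrow> 'a::real_normed_field) set"
  assumes S: "symmetric_sequence_space S N" and A: "finite A" and \<epsilon>: "\<And>n. n \<in> A \<Longrightarrow> norm (\<epsilon> n) = 1"
  shows "(\<Sum>n\<in>A. seq_scale (\<epsilon> n) (unit_seq n)) \<in> S"
    "N (\<Sum>n\<in>A. seq_scale (\<epsilon> n) (unit_seq n)) = Lambda N (card A)"
proof -
  obtain K where "quasi_normed_space seq_scale S N K"
    using S quasi_banach_imp_quasi_normed unfolding symmetric_sequence_space_def by blast
  then interpret quasi_normed_space seq_scale S N K .
  have u: "unit_seq n \<in> S" for n :: nat using S
    by (simp add: symmetric_sequence_space_def schauder_basis_def)
  show eA: "(\<Sum>n\<in>A. seq_scale (\<epsilon> n) (unit_seq n)) \<in> S"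
    by (intro subspace_sum[OF subspace_carrier] subspace_scale[OF subspace_carrier] u)
  obtain \<pi> where \<pi>: "bij \<pi>" "bij_betw \<pi> {..<card A} A" using ex_bij_image_lessThan[OF A] by blast
  define a :: "nat \<Rightarrow> 'a" where "a = (\<Sum>n<card A. unit_seq n)"
  have "(\<Sum>n\<in>B. (unit_seq n :: nat \<Rightarrow> 'a)) k = (if k \<in> B then 1 else 0)" if "finite B" for B k
    using that by (induction B) (auto simp: unit_seq_def)
  then have a: "a n = (if n < card A then 1 else 0)" for n by (simp add: a_def)
  \<comment> \<open>The signs are pulled back along \<open>\<pi>\<close>; beyond the segment any
    value of modulus 1 will do.\<close>
  define \<epsilon>' where "\<epsilon>' n = (if n < card A then \<epsilon> (\<pi> n) else 1)" for n
  have "norm (\<epsilon>' n) = 1" for n using \<epsilon> bij_betw_apply[OF \<pi>(2)] by (simp add: \<epsilon>'_def)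
  moreover have "a \<in> S" unfolding a_def by (intro subspace_sum[OF subspace_carrier] u)
  ultimately obtain g where g: "g \<in> S" "N g = N a"
    "qnorm_sums N (\<lambda>n. seq_scale (\<epsilon>' n * a n) (unit_seq (\<pi> n))) g"
    using S \<pi>(1) unfolding symmetric_sequence_space_def by metis
  have "g = (\<Sum>n\<in>A. seq_scale (\<epsilon> n) (unit_seq n))"
  proof (rule qnorm_sums_eventually_const[OF g(3,1) eA])
    fix M assume M: "card A \<le> M"
    have "(\<Sum>n<M. seq_scale (\<epsilon>' n * a n) (unit_seq (\<pi> n)))
        = (\<Sum>n<card A. seq_scale (\<epsilon>' n * a n) (unit_seq (\<pi> n)))"
      using M by (intro sum.mono_neutral_right) (auto simp: a scale_zero_left)
    also have "\<dots> = (\<Sum>n<card A. seq_scale (\<epsilon> (\<pi> n)) (unit_seq (\<pi> n)))"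
      by (intro sum.cong) (auto simp: a \<epsilon>'_def)
    also have "\<dots> = (\<Sum>n\<in>A. seq_scale (\<epsilon> n) (unit_seq n))"
      by (rule sum.reindex_bij_betw[OF \<pi>(2)])
    finally show "(\<Sum>n<M. seq_scale (\<epsilon>' n * a n) (unit_seq (\<pi> n)))
        = (\<Sum>n\<in>A. seq_scale (\<epsilon> n) (unit_seq n))" .
  qed
  then show "N (\<Sum>n\<in>A. seq_scale (\<epsilon> n) (unit_seq n)) = Lambda N (card A)"
    using g(2) by (simp add: a_def Lambda_def)
qed

text \<open>Averaging over a change of signs gives monotonicity up to K. A segment of length at most
  2m is then cut into two pieces of at most m elements, and the second one is moved back by
  symmetry.\<close>

lemma symmetric_Lambda_doubling:
  fixes S :: "(nat \<Rightarrow> 'a::real_normed_field) set"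
  assumes S: "symmetric_sequence_space S N"
  shows "\<exists>K\<ge>0. \<forall>j m. j \<le> 2 * m \<longrightarrow> Lambda N j \<le> K * Lambda N m"
proof -
  obtain K where "quasi_normed_space seq_scale S N K"
    using S quasi_banach_imp_quasi_normed unfolding symmetric_sequence_space_def by blast
  then interpret quasi_normed_space seq_scale S N K .
  have u: "unit_seq n \<in> S" for n :: nat using S
    by (simp add: symmetric_sequence_space_def schauder_basis_def)
  have sum_u: "(\<Sum>n\<in>B. unit_seq n) \<in> S" for B by (intro subspace_sum[OF subspace_carrier] u)
  have pos: "0 \<le> Lambda N m" for m unfolding Lambda_def by (rule qnorm_nonneg[OF sum_u])
  have mono: "Lambda N j \<le> K * Lambda N m" if "j \<le> m" for j m
  proof -
    \<comment> \<open>The average of 1 and \<open>\<sigma> n\<close> is the indicator of n < j, and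
      both averaged vectors have quasi-norm \<open>Lambda N m\<close>.\<close>
    define \<sigma> :: "nat \<Rightarrow> 'a" where "\<sigma> n = (if n < j then 1 else -1)" for n
    note \<sigma> = symmetric_norm_signs[OF S, of "{..<m}" \<sigma>]
    have \<sigma>S: "(\<Sum>n<m. seq_scale (\<sigma> n) (unit_seq n)) \<in> S"
      and \<sigma>N: "N (\<Sum>n<m. seq_scale (\<sigma> n) (unit_seq n)) = Lambda N m"
      using \<sigma> by (auto simp: \<sigma>_def)
    have "(\<Sum>n<j. unit_seq n) = (\<Sum>n<m. seq_scale (1/2 + 1/2 * \<sigma> n) (unit_seq n))"
    proof -
      have "(\<Sum>n<m. seq_scale (1/2 + 1/2 * \<sigma> n) (unit_seq n))
          = (\<Sum>n<j. seq_scale (1/2 + 1/2 * \<sigma> n) (unit_seq n))"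
        using that by (intro sum.mono_neutral_right) (auto simp: \<sigma>_def scale_zero_left)
      also have "\<dots> = (\<Sum>n<j. unit_seq n)" by (intro sum.cong) (auto simp: \<sigma>_def)
      finally show ?thesis by simp
    qed
    also have "\<dots> = seq_scale (1/2) (\<Sum>n<m. unit_seq n)
        + seq_scale (1/2) (\<Sum>n<m. seq_scale (\<sigma> n) (unit_seq n))"
      by (simp only: scale_left_distrib sum.distrib scale_sum_right scale_scale)
    finally have "Lambda N j \<le> K * (N (seq_scale (1/2) (\<Sum>n<m. unit_seq n))
        + N (seq_scale (1/2) (\<Sum>n<m. seq_scale (\<sigma> n) (unit_seq n))))"
      unfolding Lambda_def using \<sigma>S sum_u
      by (simp only:) (intro qnorm_triangle subspace_scale[OF subspace_carrier])
    also have "\<dots> = K * Lambda N m"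
      using qnorm_scale[OF sum_u, of "1/2" "{..<m}"] qnorm_scale[OF \<sigma>S, of "1/2"] \<sigma>N
      by (simp add: Lambda_def norm_divide)
    finally show ?thesis .
  qed
  have "Lambda N j \<le> (K * (1 + K)) * Lambda N m" if "j \<le> 2 * m" for j m
  proof (cases "j \<le> m")
    case True
    have "Lambda N j \<le> K * Lambda N m" using mono True .
    also have "\<dots> \<le> (K * (1 + K)) * Lambda N m"
      using const_ge pos by (intro mult_right_mono) auto
    finally show ?thesis .
  next
    case False
    note shift = symmetric_norm_signs[OF S, of "{m..<j}" "\<lambda>_. 1"]
    have "{..<j} = {..<m} \<union> {m..<j}" using False by auto
    then have "(\<Sum>n<j. unit_seq n) = (\<Sum>n<m. unit_seq n) + (\<Sum>n=m..<j. (unit_seq n :: nat \<Rightarrow> 'a))"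
      using sum.union_disjoint[of "{..<m}" "{m..<j}" "unit_seq :: nat \<Rightarrow> nat \<Rightarrow> 'a"]
      by (simp add: ivl_disj_int)
    then have "Lambda N j \<le> K * (Lambda N m + N (\<Sum>n=m..<j. unit_seq n))"
      unfolding Lambda_def using qnorm_triangle[OF sum_u sum_u] by simp
    also have "N (\<Sum>n=m..<j. unit_seq n) = Lambda N (j - m)" using shift by simp
    also have "K * (Lambda N m + Lambda N (j - m)) \<le> K * (Lambda N m + K * Lambda N m)"
      using const_ge that by (intro mult_left_mono add_left_mono mono) auto
    finally show ?thesis by (simp add: algebra_simps)
  qed
  then show ?thesis using const_ge by (intro exI[of _ "K * (1 + K)"]) auto
qed

section \<open>Signed sums of a squeeze-symmetric sequence\<close>

text \<open>The series transform bounds a signed sum above by \<Lambda>[S1], the coefficient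
  transform bounds it below by \<Lambda>[S2], and these are equivalent. Doubling supplies the factor
  2 in the cardinalities, as a sum of m differences is a signed sum of 2m vectors.\<close>

lemma squeeze_symmetric_superdemocratic:
  assumes qn: "quasi_normed_space scl V N K" and sq: "squeeze_symmetric_sequence scl V N x"
  shows "\<exists>D>0. \<forall>A B \<epsilon> \<eta>. finite A \<longrightarrow> finite B \<longrightarrow> card B \<le> 2 * card A \<longrightarrow>
      (\<forall>n\<in>B. norm (\<epsilon> n) = 1) \<longrightarrow> (\<forall>n\<in>A. norm (\<eta> n) = 1) \<longrightarrow>
      N (\<Sum>n\<in>B. scl (\<epsilon> n) (x n)) \<le> D * N (\<Sum>n\<in>A. scl (\<eta> n) (x n))"
    and "\<And>n. x n \<in> V" and "\<And>n. 0 < N (x n)"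
proof -
  interpret Z: quasi_normed_space scl V N K by (fact qn)
  obtain xs S1 N1 S2 N2 where bi: "biorthogonal_system scl V N x xs"
    and S1: "symmetric_sequence_space S1 N1" and S2: "symmetric_sequence_space S2 N2"
    and se: "series_transform_bounded scl V N x S1 N1"
    and co: "coefficient_transform_bounded V N xs S2 N2"
    and eq: "seq_equivalent (\<lambda>m. ennreal (Lambda N1 m)) (\<lambda>m. ennreal (Lambda N2 m))"
    using sq unfolding squeeze_symmetric_sequence_def squeeze_symmetric_system_def by blast
  show xV: "x n \<in> V" for n using bi by (simp add: biorthogonal_system_def)
  have xs_add: "xs n (f + g) = xs n f + xs n g" if "f \<in> V" "g \<in> V" for n f g
    using bi that by (auto simp: biorthogonal_system_def dual_space_def)
  have xs_scl: "xs n (scl c f) = c * xs n f" if "f \<in> V" for n f c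
    using bi that by (auto simp: biorthogonal_system_def dual_space_def)
  have xs0: "xs n 0 = 0" for n using xs_scl[OF xV, of n 0 0] by simp
  have xs_x: "xs m (x n) = (if m = n then 1 else 0)" for m n
    using bi by (simp add: biorthogonal_system_def)
  show "0 < N (x n)" for n
    using xs0[of n] xs_x[of n n] Z.qnorm_eq_0[OF xV[of n]] Z.qnorm_nonneg[OF xV[of n]] by fastforce
  have sumV: "(\<Sum>n\<in>A. scl (\<epsilon> n) (x n)) \<in> V" for A \<epsilon>
    by (intro Z.subspace_sum[OF Z.subspace_carrier] Z.subspace_scale[OF Z.subspace_carrier] xV)
  have xs_sum: "xs k (\<Sum>n\<in>A. scl (\<epsilon> n) (x n)) = (if k \<in> A then \<epsilon> k else 0)" if "finite A" for A \<epsilon> k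
    using that
  proof (induction A)
    case (insert n A)
    then show ?case
      using xs_add[OF Z.subspace_scale[OF Z.subspace_carrier xV] sumV] by (auto simp: xs_scl[OF xV] xs_x)
  qed (simp add: xs0)
  have unit_sum: "(\<Sum>n\<in>A. seq_scale (\<epsilon> n) (unit_seq n)) = (\<lambda>k. if k \<in> A then \<epsilon> k else 0)"
    if "finite A" for A and \<epsilon> :: "nat \<Rightarrow> 'a"
    using that by (induction A) (auto simp: fun_eq_iff unit_seq_def seq_scale_def)
  obtain C1 where C1: "\<And>a. a \<in> S1 \<Longrightarrow> \<exists>f\<in>V. qnorm_sums N (\<lambda>n. scl (a n) (x n)) f \<and> N f \<le> C1 * N1 a"
    using se by (auto simp: series_transform_bounded_def)
  obtain C2 where C2: "\<And>f. f \<in> V \<Longrightarrow> N2 (\<lambda>n. xs n f) \<le> C2 * N f"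
    using co by (auto simp: coefficient_transform_bounded_def)
  obtain C where C: "C > 0" "\<And>m. m \<ge> 1 \<Longrightarrow> ennreal (Lambda N1 m) \<le> ennreal C * ennreal (Lambda N2 m)"
    using eq by (auto simp: seq_equivalent_def)
  obtain L where L: "L \<ge> 0" "\<And>j m. j \<le> 2 * m \<Longrightarrow> Lambda N1 j \<le> L * Lambda N1 m"
    using symmetric_Lambda_doubling[OF S1] by blast
  have pos: "0 \<le> Lambda N' m" if "symmetric_sequence_space S' N'" for S' N' and m :: nat
  proof -
    have "quasi_banach_space seq_scale S' N'" using that by (simp add: symmetric_sequence_space_def)
    from quasi_banach_space.qnorm_nonneg[OF this symmetric_norm_signs(1)[OF that, of "{..<m}" "\<lambda>_. 1"]]
      symmetric_norm_signs(2)[OF that, of "{..<m}" "\<lambda>_. 1"]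
    show ?thesis by simp
  qed
  have up: "N (\<Sum>n\<in>B. scl (\<epsilon> n) (x n)) \<le> \<bar>C1\<bar> * Lambda N1 (card B)"
    if B: "finite B" and \<epsilon>: "\<And>n. n \<in> B \<Longrightarrow> norm (\<epsilon> n) = 1" for B \<epsilon>
  proof -
    define a where "a = (\<Sum>n\<in>B. seq_scale (\<epsilon> n) (unit_seq n))"
    have sym: "a \<in> S1" "N1 a = Lambda N1 (card B)"
      unfolding a_def using symmetric_norm_signs[OF S1 B, of \<epsilon>] \<epsilon> by auto
    obtain f where f: "f \<in> V" "qnorm_sums N (\<lambda>n. scl (a n) (x n)) f" "N f \<le> C1 * N1 a"
      using C1[OF sym(1)] by blast
    obtain m where m: "B \<subseteq> {..<m}" using B finite_nat_iff_bounded by blast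
    have "f = (\<Sum>n\<in>B. scl (\<epsilon> n) (x n))"
    proof (rule Z.qnorm_sums_eventually_const[OF f(2,1) sumV])
      fix M assume "m \<le> M"
      then have "(\<Sum>n<M. scl (a n) (x n)) = (\<Sum>n\<in>B. scl (a n) (x n))"
        using m B by (intro sum.mono_neutral_right) (auto simp: a_def unit_sum)
      also have "\<dots> = (\<Sum>n\<in>B. scl (\<epsilon> n) (x n))" using B by (simp add: a_def unit_sum)
      finally show "(\<Sum>n<M. scl (a n) (x n)) = (\<Sum>n\<in>B. scl (\<epsilon> n) (x n))" .
    qed
    then have "N (\<Sum>n\<in>B. scl (\<epsilon> n) (x n)) \<le> C1 * Lambda N1 (card B)" using f(3) sym(2) by simp
    also have "\<dots> \<le> \<bar>C1\<bar> * Lambda N1 (card B)" using pos[OF S1] by (intro mult_right_mono) auto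
    finally show ?thesis .
  qed
  have low: "Lambda N2 (card A) \<le> \<bar>C2\<bar> * N (\<Sum>n\<in>A. scl (\<eta> n) (x n))"
    if A: "finite A" and \<eta>: "\<And>n. n \<in> A \<Longrightarrow> norm (\<eta> n) = 1" for A \<eta>
  proof -
    have "(\<lambda>k. xs k (\<Sum>n\<in>A. scl (\<eta> n) (x n))) = (\<Sum>n\<in>A. seq_scale (\<eta> n) (unit_seq n))"
      using A by (simp add: xs_sum unit_sum)
    then have "Lambda N2 (card A) \<le> C2 * N (\<Sum>n\<in>A. scl (\<eta> n) (x n))"
      using C2[OF sumV, of \<eta> A] symmetric_norm_signs(2)[OF S2 A \<eta>] by simp
    also have "\<dots> \<le> \<bar>C2\<bar> * N (\<Sum>n\<in>A. scl (\<eta> n) (x n))"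
      using Z.qnorm_nonneg[OF sumV] by (intro mult_right_mono) auto
    finally show ?thesis .
  qed
  \<comment> \<open>The product of the constants of the upper bound, doubling, equivalence and lower
    bound; the \<open>1\<close> keeps \<open>D\<close> positive, and absolute values are taken as
    \<open>C1\<close> and \<open>C2\<close> come without a sign.\<close>
  define D where "D = \<bar>C1\<bar> * (L * (C * \<bar>C2\<bar>)) + 1"
  have "N (\<Sum>n\<in>B. scl (\<epsilon> n) (x n)) \<le> D * N (\<Sum>n\<in>A. scl (\<eta> n) (x n))"
    if A: "finite A" and B: "finite B" and card: "card B \<le> 2 * card A"
      and \<epsilon>: "\<forall>n\<in>B. norm (\<epsilon> n) = 1" and \<eta>: "\<forall>n\<in>A. norm (\<eta> n) = 1" for A B \<epsilon> \<eta>
  \<comment> \<open>The equivalence of the fundamental functions speaks only of m \<ge> 1.\<close>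
  proof (cases "A = {}")
    case True
    then have "B = {}" using card B by simp
    then show ?thesis using True Z.qnorm_zero by simp
  next
    case False
    then have "1 \<le> card A" using A by (simp add: Suc_leI card_gt_0_iff)
    then have "ennreal (Lambda N1 (card A)) \<le> ennreal (C * Lambda N2 (card A))"
      using C pos[OF S2] by (simp add: ennreal_mult)
    then have N12: "Lambda N1 (card A) \<le> C * Lambda N2 (card A)"
      using C(1) pos[OF S2, of "card A"] by (subst (asm) ennreal_le_iff) auto
    have "N (\<Sum>n\<in>B. scl (\<epsilon> n) (x n)) \<le> \<bar>C1\<bar> * Lambda N1 (card B)" using up B \<epsilon> by blast
    also have "\<dots> \<le> \<bar>C1\<bar> * (L * Lambda N1 (card A))" using L(2)[OF card] by (intro mult_left_mono) auto
    also have "\<dots> \<le> \<bar>C1\<bar> * (L * (C * Lambda N2 (card A)))" using N12 L(1) by (intro mult_left_mono) auto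
    also have "\<dots> \<le> \<bar>C1\<bar> * (L * (C * (\<bar>C2\<bar> * N (\<Sum>n\<in>A. scl (\<eta> n) (x n)))))"
      using low[OF A, of \<eta>] \<eta> L(1) C(1) by (intro mult_left_mono) auto
    also have "\<dots> \<le> D * N (\<Sum>n\<in>A. scl (\<eta> n) (x n))"
      using Z.qnorm_nonneg[OF sumV, of \<eta> A] by (simp add: D_def algebra_simps)
    finally show ?thesis .
  qed
  moreover have "0 < D" using L(1) C(1) by (simp add: D_def add_nonneg_pos)
  ultimately show "\<exists>D>0. \<forall>A B \<epsilon> \<eta>. finite A \<longrightarrow> finite B \<longrightarrow> card B \<le> 2 * card A \<longrightarrow>
      (\<forall>n\<in>B. norm (\<epsilon> n) = 1) \<longrightarrow> (\<forall>n\<in>A. norm (\<eta> n) = 1) \<longrightarrow>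
      N (\<Sum>n\<in>B. scl (\<epsilon> n) (x n)) \<le> D * N (\<Sum>n\<in>A. scl (\<eta> n) (x n))"
    by blast
qed

section \<open>The gliding hump\<close>

text \<open>The vector index \<open>n\<close> depends on the left end \<open>a\<close> of its
  interval, and the right end \<open>b\<close> depends on \<open>n\<close> and is the next left end.
  \<open>L k\<close> is the threshold beyond which step \<open>k\<close> can be carried out, so
  \<open>b\<close> has to clear \<open>L (Suc k)\<close> in advance.\<close>

lemma interleaved_choice:
  fixes R :: "nat \<Rightarrow> nat \<Rightarrow> nat \<Rightarrow> nat \<Rightarrow> bool"
  assumes step: "\<And>k a n0. a \<ge> L k \<Longrightarrow> \<exists>n>n0. \<exists>b>a. b \<ge> L (Suc k) \<and> R k n a b"
  shows "\<exists>\<nu> \<kappa>. strict_mono \<nu> \<and> strict_mono \<kappa> \<and> a0 \<le> \<kappa> 0 \<and> (\<forall>k. R k (\<nu> k) (\<kappa> k) (\<kappa> (Suc k)))"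
proof -
  let ?P = "\<lambda>k (a, n, b). a0 \<le> a \<and> a < b \<and> L (Suc k) \<le> b \<and> R k n a b"
  let ?Q = "\<lambda>k (a, n, b) (a', n', b'). a' = b \<and> n < n'"
  have "\<exists>f :: nat \<Rightarrow> nat \<times> nat \<times> nat. \<forall>k. ?P k (f k) \<and> ?Q k (f k) (f (Suc k))"
  proof (rule dependent_nat_choice)
    show "\<exists>x. ?P 0 x"
    proof -
      obtain n b where "b > max a0 (L 0)" "b \<ge> L (Suc 0)" "R 0 n (max a0 (L 0)) b"
        using step[where k = 0 and a = "max a0 (L 0)" and ?n0.0 = 0] by auto
      then show ?thesis by (intro exI[of _ "(max a0 (L 0), n, b)"]) auto
    qed
  next
    fix x :: "nat \<times> nat \<times> nat" and k assume x: "?P k x"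
    obtain a n b where [simp]: "x = (a, n, b)" by (cases x)
    obtain n' b' where "n' > n" "b' > b" "b' \<ge> L (Suc (Suc k))" "R (Suc k) n' b b'"
      using step[where k = "Suc k" and a = b and ?n0.0 = n] x by fastforce
    moreover have "a0 \<le> b" using x by simp
    ultimately show "\<exists>y. ?P (Suc k) y \<and> ?Q k x y"
      by (intro exI[of _ "(b, n', b')"]) simp
  qed
  then obtain f where "\<forall>k. ?P k (f k) \<and> ?Q k (f k) (f (Suc k))" ..
  note f = this[THEN spec, THEN conjunct1] this[THEN spec, THEN conjunct2]
  define \<nu> where "\<nu> k = fst (snd (f k))" for k
  define \<kappa> where "\<kappa> k = fst (f k)" for k
  have fk: "f k = (\<kappa> k, \<nu> k, \<kappa> (Suc k))" for k
    using f(2)[of k] by (cases "f k"; cases "f (Suc k)") (auto simp: \<nu>_def \<kappa>_def)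
  have "strict_mono \<nu>" using f(2) unfolding fk by (auto intro: strict_monoI_Suc)
  moreover have "strict_mono \<kappa>" using f(1) unfolding fk by (auto intro: strict_monoI_Suc)
  ultimately show ?thesis using f(1) unfolding fk by auto
qed

text \<open>The vector of step \<open>k\<close> splits into \<open>steady k\<close>, living in the rows below \<open>\<kappa> k\<close> whose norms
  do not vanish in the limit and in the columns of the \<open>k\<close>-th interval, into \<open>fresh k\<close>, living in
  the rows of the \<open>k\<close>-th interval, and into an error. The steady parts are disjoint within each row,
  so they add up like in \<open>\<ell>\<^sub>p\<close>; the fresh parts have disjoint rows, so they add up like
  in \<open>\<ell>\<^sub>q\<close>.\<close>

locale gliding_hump =
  fixes p q :: ennreal and z :: "nat \<Rightarrow> nat \<Rightarrow> nat \<Rightarrow> 'a::real_normed_field"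
    and \<kappa> :: "nat \<Rightarrow> nat" and c :: "nat \<Rightarrow> real" and B \<eta> :: real
  assumes p: "0 < p" and q: "0 < q" and z: "z k \<in> mixed_space p q"
    and bounded: "mixed_norm p q (z k) \<le> B" and mono: "strict_mono \<kappa>"
    and c: "0 \<le> c i" and \<eta>: "0 \<le> \<eta>"
    and rows: "i < \<kappa> k \<Longrightarrow> c i \<noteq> 0 \<Longrightarrow> c i / 2 \<le> lp_norm p (z k i) \<and> lp_norm p (z k i) \<le> 2 * c i"
    and small: "mixed_norm p q (restrict_to
      ({(i, j). i < \<kappa> k \<and> (c i = 0 \<or> j < \<kappa> k)} \<union> - ({..<\<kappa> (Suc k)} \<times> {..<\<kappa> (Suc k)})) (z k))
      \<le> \<eta> / (2 * mixed_const p q) ^ Suc k"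
begin

abbreviation "K \<equiv> mixed_const p q"

definition "steady k = restrict_to {(i, j). i < \<kappa> k \<and> c i \<noteq> 0 \<and> \<kappa> k \<le> j \<and> j < \<kappa> (Suc k)} (z k)"

definition "fresh k = restrict_to {(i, j). \<kappa> k \<le> i \<and> i < \<kappa> (Suc k) \<and> j < \<kappa> (Suc k)} (z k)"

definition "error k = restrict_to
  ({(i, j). i < \<kappa> k \<and> (c i = 0 \<or> j < \<kappa> k)} \<union> - ({..<\<kappa> (Suc k)} \<times> {..<\<kappa> (Suc k)})) (z k)"

lemma K_ge: "1 \<le> K" by (rule mixed_const_ge)

lemma B_nonneg: "0 \<le> B"
  using bounded[of 0] mixed_norm_nonneg[OF z, of 0] by linarith

lemma \<kappa>_less: "\<kappa> k < \<kappa> (Suc k)"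
  using mono by (simp add: strict_mono_Suc_iff)

lemma \<kappa>_interval_unique:
  assumes "\<kappa> j \<le> i" "i < \<kappa> (Suc j)" "\<kappa> k \<le> i" "i < \<kappa> (Suc k)"
  shows "j = k"
proof -
  have "\<kappa> j < \<kappa> (Suc k)" "\<kappa> k < \<kappa> (Suc j)" using assms by linarith+
  then show ?thesis using mono by (simp add: strict_mono_less)
qed

lemma parts_in: "steady k \<in> mixed_space p q" "fresh k \<in> mixed_space p q" "error k \<in> mixed_space p q"
  unfolding steady_def fresh_def error_def by (rule restrict_to_in[OF z p q])+

lemma sums_in: "(\<Sum>k<m. steady k) \<in> mixed_space p q" "(\<Sum>k<m. fresh k) \<in> mixed_space p q"
  "(\<Sum>k<m. error k) \<in> mixed_space p q" "(\<Sum>k<m. z k) \<in> mixed_space p q"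
  by (rule mixed_sum_in[OF p q], rule parts_in z)+

lemma split: "z k = steady k + fresh k + error k"
  using \<kappa>_less[of k]
  by (auto simp: fun_eq_iff steady_def fresh_def error_def restrict_to_def)

lemma split_sum: "(\<Sum>k<m. z k) = (\<Sum>k<m. steady k) + (\<Sum>k<m. fresh k) + (\<Sum>k<m. error k)"
proof -
  have "(\<Sum>k<m. z k) = (\<Sum>k<m. steady k + fresh k + error k)" using split by (intro sum.cong) auto
  then show ?thesis by (simp only: sum.distrib)
qed

lemma error_sum: "mixed_norm p q (\<Sum>k<m. error k) \<le> \<eta>"
  by (rule mixed_sum_small[OF p q parts_in(3) _ \<eta>]) (use small in \<open>simp add: error_def\<close>)

lemma geometric_le: "\<eta> / (2 * K) ^ Suc k \<le> \<eta>"
proof -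
  have "\<eta> * 1 \<le> \<eta> * (2 * K) ^ Suc k"
    using K_ge \<eta> by (intro mult_left_mono one_le_power) auto
  then show ?thesis using K_ge by (simp add: divide_le_eq del: power_Suc)
qed

lemma error_le: "mixed_norm p q (error k) \<le> \<eta>"
  using small[of k] geometric_le[of k] by (simp add: error_def)

lemma steady_disjoint: "steady j i l \<noteq> 0 \<Longrightarrow> steady k i l \<noteq> 0 \<Longrightarrow> j = k"
  using \<kappa>_interval_unique[of j l k] by (auto simp: steady_def restrict_to_def split: if_splits)

lemma fresh_disjoint: "fresh j i \<noteq> (\<lambda>_. 0) \<Longrightarrow> fresh k i \<noteq> (\<lambda>_. 0) \<Longrightarrow> j = k"
  using \<kappa>_interval_unique[of j i k] by (auto simp: fresh_def restrict_to_def fun_eq_iff split: if_splits)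

text \<open>A steady entry has its column in a later block than its row, a fresh entry in no later
  block.\<close>

lemma steady_fresh_disjoint: "steady j i l = 0 \<or> fresh k i l = 0"
proof (rule ccontr)
  assume "\<not> ?thesis"
  then have h: "i < \<kappa> j" "\<kappa> j \<le> l" "\<kappa> k \<le> i" "l < \<kappa> (Suc k)"
    by (auto simp: steady_def fresh_def restrict_to_def split: if_splits)
  then have "\<kappa> k < \<kappa> j" "\<kappa> j < \<kappa> (Suc k)" by linarith+
  then show False using mono by (simp add: strict_mono_less)
qed

lemma steady_fresh_sum_disjoint: "(\<Sum>k<m. steady k) i l = 0 \<or> (\<Sum>k<m. fresh k) i l = 0"
proof (cases "\<exists>j. steady j i l \<noteq> 0")
  case True
  then have "fresh k i l = 0" for k using steady_fresh_disjoint by blast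
  then show ?thesis by (simp add: sum_apply_apply)
next
  case False
  then show ?thesis by (simp add: sum_apply_apply)
qed

text \<open>Steady and fresh entries never meet and so cannot cancel: where the steady sum is
  nonzero, it equals the full sum minus the error sum.\<close>

lemma steady_sum_le: "mixed_norm p q (\<Sum>k<m. steady k) \<le> K * (mixed_norm p q (\<Sum>k<m. z k) + \<eta>)"
proof -
  have "mixed_norm p q (\<Sum>k<m. steady k)
      \<le> K * (mixed_norm p q (\<Sum>k<m. z k) + mixed_norm p q (\<Sum>k<m. error k))"
  proof (rule mixed_triangle_le(2)[OF sums_in(4,3) p q])
    fix i l
    show "norm ((\<Sum>k<m. steady k) i l) \<le> norm ((\<Sum>k<m. z k) i l) + norm ((\<Sum>k<m. error k) i l)"
      using steady_fresh_sum_disjoint[of m i l]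
        norm_triangle_ineq4[of "(\<Sum>k<m. z k) i l" "(\<Sum>k<m. error k) i l"]
      unfolding split_sum by auto
  qed
  also have "\<dots> \<le> K * (mixed_norm p q (\<Sum>k<m. z k) + \<eta>)"
    using error_sum K_ge by (intro mult_left_mono add_left_mono) auto
  finally show ?thesis .
qed

lemma fresh_sum_le: "mixed_norm p q (\<Sum>k<m. fresh k) \<le> K * (mixed_norm p q (\<Sum>k<m. z k) + \<eta>)"
proof -
  have "mixed_norm p q (\<Sum>k<m. fresh k)
      \<le> K * (mixed_norm p q (\<Sum>k<m. z k) + mixed_norm p q (\<Sum>k<m. error k))"
  proof (rule mixed_triangle_le(2)[OF sums_in(4,3) p q])
    fix i l
    show "norm ((\<Sum>k<m. fresh k) i l) \<le> norm ((\<Sum>k<m. z k) i l) + norm ((\<Sum>k<m. error k) i l)"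
      using steady_fresh_sum_disjoint[of m i l]
        norm_triangle_ineq4[of "(\<Sum>k<m. z k) i l" "(\<Sum>k<m. error k) i l"]
      unfolding split_sum by auto
  qed
  also have "\<dots> \<le> K * (mixed_norm p q (\<Sum>k<m. z k) + \<eta>)"
    using error_sum K_ge by (intro mult_left_mono add_left_mono) auto
  finally show ?thesis .
qed

lemma sum_le: "mixed_norm p q (\<Sum>k<m. z k)
  \<le> K * (K * (mixed_norm p q (\<Sum>k<m. steady k) + mixed_norm p q (\<Sum>k<m. fresh k)) + \<eta>)"
proof -
  have "mixed_norm p q (\<Sum>k<m. z k)
      \<le> K * (mixed_norm p q ((\<Sum>k<m. steady k) + (\<Sum>k<m. fresh k)) + mixed_norm p q (\<Sum>k<m. error k))"
    unfolding split_sum by (rule mixed_add(2)[OF mixed_add(1)[OF sums_in(1,2) p q] sums_in(3) p q])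
  also have "\<dots> \<le> K * (K * (mixed_norm p q (\<Sum>k<m. steady k) + mixed_norm p q (\<Sum>k<m. fresh k)) + \<eta>)"
    using error_sum K_ge mixed_add(2)[OF sums_in(1,2) p q] by (intro mult_left_mono add_mono) auto
  finally show ?thesis .
qed

lemma sum_row: "(\<Sum>k\<in>S. f k) i = (\<Sum>k\<in>S. f k i)" for f :: "nat \<Rightarrow> nat \<Rightarrow> nat \<Rightarrow> 'a"
  by (induction S rule: infinite_finite_induct) auto

section \<open>Growth of the steady and of the fresh sums\<close>

lemma norm_steady_sum: "norm ((\<Sum>k<m. steady k) i l) = (\<Sum>k<m. norm (steady k i l))"
  unfolding sum_apply_apply
  by (rule sum_at_most_one_nonzero) (use steady_disjoint in auto)

lemma steady_row_le: "lp_norm p (steady k i) \<le> 2 * c i"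
proof (cases "i < \<kappa> k \<and> c i \<noteq> 0")
  case True
  have "lp_norm p (steady k i) \<le> 1 * lp_norm p (z k i)"
    by (rule lp_mono(2)[OF mixed_memD(1)[OF z] p]) (auto simp: steady_def restrict_to_def)
  then show ?thesis using rows[of i k] True by simp
next
  case False
  then have "steady k i = (\<lambda>_. 0)" by (auto simp: steady_def restrict_to_def)
  then show ?thesis using c[of i] by (simp add: lp_zero)
qed

text \<open>Every row that occurs lies below \<open>\<kappa> (m - 1)\<close>, so the last vector has
  row norm at least c_i / 2 there, while each steady row has norm at most 2 c_i. The quotient is the
  constant 4, and the outer norm is taken of the last vector alone.\<close>

lemma steady_upper:
  assumes m: "m \<ge> 1"
  shows "mixed_norm p q (\<Sum>k<m. steady k) \<le> 4 * B * real m powr enn2real (1 / p)"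
proof -
  define t where "t = real m powr enn2real (1 / p)"
  have t: "0 \<le> t" by (simp add: t_def)
  have row: "lp_norm p ((\<Sum>k<m. steady k) i) \<le> (4 * t) * lp_norm p (z (m - 1) i)" for i
  proof (cases "i < \<kappa> (m - 1) \<and> c i \<noteq> 0")
    case True
    have "lp_norm p ((\<Sum>k<m. steady k) i) \<le> t * (2 * c i)"
      unfolding t_def
    proof (rule lp_disjoint_upper[where a = "\<lambda>k. steady k i", OF p m mixed_memD(1)[OF parts_in(1)] _ _ steady_row_le])
      show "j = k" if "steady j i l \<noteq> 0" "steady k i l \<noteq> 0" for j k l
        by (rule steady_disjoint[OF that])
    qed (simp only: norm_steady_sum)
    also have "\<dots> \<le> t * (4 * lp_norm p (z (m - 1) i))"
      using rows[of i "m - 1"] True t by (intro mult_left_mono) auto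
    finally show ?thesis by (simp add: mult_ac)
  next
    case False
    have "steady k i l = 0" if "k < m" for k l
    proof -
      have "\<kappa> k \<le> \<kappa> (m - 1)" using that by (intro strict_mono_leD[OF mono]) simp
      then show ?thesis using False by (auto simp: steady_def restrict_to_def)
    qed
    then have "(\<Sum>k<m. steady k) i = (\<lambda>_. 0)" by (auto simp: fun_eq_iff sum_apply_apply)
    then show ?thesis using t lp_norm_nonneg[OF mixed_memD(1)[OF z]] by (simp add: lp_zero)
  qed
  have "mixed_norm p q (\<Sum>k<m. steady k) \<le> (4 * t) * mixed_norm p q (z (m - 1))"
    unfolding mixed_norm_def
  proof (rule lp_mono(2)[OF mixed_memD(2)[OF z] q])
    fix i
    show "norm (lp_norm p ((\<Sum>k<m. steady k) i)) \<le> 4 * t * norm (lp_norm p (z (m - 1) i))"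
      using row[of i] lp_norm_nonneg[OF mixed_memD(1)[OF sums_in(1)], of m i]
        lp_norm_nonneg[OF mixed_memD(1)[OF z], of "m - 1" i] by simp
  qed (use t in simp)
  also have "\<dots> \<le> (4 * t) * B" using t bounded by (intro mult_left_mono) auto
  finally show ?thesis by (simp add: t_def mult_ac)
qed

lemma steady_zero:
  assumes "\<And>i. c i = 0"
  shows "mixed_norm p q (\<Sum>k<m. steady k) = 0"
proof -
  have "(\<Sum>k<m. steady k) = 0" using assms by (auto simp: fun_eq_iff sum_apply_apply steady_def restrict_to_def)
  then show ?thesis by (simp only: mixed_zero)
qed

text \<open>One row suffices if it is present from the start. Fresh parts vanish in it, so c_i / 2
  is at most K times the steady row norm plus \<eta>; an error of at most c_i / (4K) leaves c_i /
  (4K) for the steady part.\<close>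

lemma steady_lower:
  assumes m: "m \<ge> 1" and i: "i < \<kappa> 0" "c i \<noteq> 0" "\<eta> \<le> c i / (4 * K)"
  shows "c i / (4 * K) * real m powr enn2real (1 / p) \<le> mixed_norm p q (\<Sum>k<m. steady k)"
proof -
  have low: "c i / (4 * K) \<le> lp_norm p (steady k i)" for k
  proof -
    have ik: "i < \<kappa> k" using i(1) strict_mono_leD[OF mono, of 0 k] by simp
    then have "fresh k i = (\<lambda>_. 0)" by (auto simp: fresh_def restrict_to_def)
    then have zk: "z k i l = steady k i l + error k i l" for l
      by (subst split) simp
    have "c i / 2 \<le> lp_norm p (z k i)" using rows[OF ik i(2)] by simp
    also have "\<dots> \<le> 1 * lp_const p * (lp_norm p (steady k i) + lp_norm p (error k i))"
      by (rule lp_triangle(2)[OF mixed_memD(1)[OF parts_in(1)] mixed_memD(1)[OF parts_in(3)] p])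
        (auto simp: zk norm_triangle_ineq)
    also have "\<dots> \<le> K * (lp_norm p (steady k i) + \<eta>)"
    proof -
      have "lp_const p * 1 \<le> K" unfolding mixed_const_def
        using lp_const_ge[of p] lp_const_ge[of q] by (intro mult_left_mono) auto
      moreover have "lp_norm p (error k i) \<le> \<eta>"
        using row_norm_le[OF parts_in(3) q] error_le order_trans by blast
      ultimately show ?thesis
        using K_ge lp_norm_nonneg[OF mixed_memD(1)[OF parts_in(1)], of k i]
          lp_norm_nonneg[OF mixed_memD(1)[OF parts_in(3)], of k i]
        by (intro mult_mono add_left_mono) auto
    qed
    also have "\<dots> \<le> K * (lp_norm p (steady k i) + c i / (4 * K))"
      using i(3) K_ge by (intro mult_left_mono) auto
    finally show ?thesis using K_ge by (simp add: field_simps)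
  qed
  have "real m powr enn2real (1 / p) * (c i / (4 * K)) \<le> lp_norm p ((\<Sum>k<m. steady k) i)"
  proof (rule lp_disjoint_lower[where a = "\<lambda>k. steady k i", OF p m _ mixed_memD(1)[OF sums_in(1)]
          mixed_memD(1)[OF parts_in(1)] _ _ low])
    show "0 \<le> c i / (4 * K)" using c[of i] K_ge by simp
    show "j = k" if "steady j i l \<noteq> 0" "steady k i l \<noteq> 0" for j k l
      by (rule steady_disjoint[OF that])
  qed (simp only: norm_steady_sum)
  also have "\<dots> \<le> mixed_norm p q (\<Sum>k<m. steady k)" by (rule row_norm_le[OF sums_in(1) q])
  finally show ?thesis by (simp add: mult_ac)
qed

lemma norm_fresh_sum_row:
  "norm (lp_norm p ((\<Sum>k<m. fresh k) i)) = (\<Sum>k<m. norm (lp_norm p (fresh k i)))"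
  unfolding sum_row
  by (rule sum_at_most_one_nonzero[where h = "\<lambda>f. norm (lp_norm p f)"])
    (use fresh_disjoint in \<open>auto simp: func_zero lp_zero\<close>)

lemma fresh_norm_disjoint:
  assumes "lp_norm p (fresh j i) \<noteq> 0" "lp_norm p (fresh k i) \<noteq> 0" shows "j = k"
  by (rule fresh_disjoint[of j i k]) (use assms lp_zero(2) in metis)+

lemma fresh_upper:
  assumes m: "m \<ge> 1"
  shows "mixed_norm p q (\<Sum>k<m. fresh k) \<le> B * real m powr enn2real (1 / q)"
proof -
  have "mixed_norm p q (fresh k) \<le> B" for k
    using restrict_to_le[OF z p q] bounded order_trans unfolding fresh_def by blast
  then have "mixed_norm p q (\<Sum>k<m. fresh k) \<le> real m powr enn2real (1 / q) * B"
    unfolding mixed_norm_def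
  proof (intro lp_disjoint_upper[where a = "\<lambda>k i. lp_norm p (fresh k i)", OF q m mixed_memD(2)[OF parts_in(2)]])
    show "j = k" if "lp_norm p (fresh j i) \<noteq> 0" "lp_norm p (fresh k i) \<noteq> 0" for i j k
      by (rule fresh_norm_disjoint[OF that])
  qed (simp_all only: norm_fresh_sum_row)
  then show ?thesis by (simp add: mult_ac)
qed

text \<open>From row \<open>\<kappa> k\<close> on, \<open>z k\<close> consists of its fresh part and
  of error entries only; half of \<beta> / K is given up to the error.\<close>

lemma fresh_lower:
  assumes m: "m \<ge> 1" and \<beta>: "0 \<le> \<beta>" "\<eta> \<le> \<beta> / (2 * K)"
    "\<And>k. \<beta> \<le> mixed_norm p q (restrict_to ({\<kappa> k..} \<times> UNIV) (z k))"
  shows "\<beta> / (2 * K) * real m powr enn2real (1 / q) \<le> mixed_norm p q (\<Sum>k<m. fresh k)"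
proof -
  have "\<beta> / (2 * K) \<le> mixed_norm p q (fresh k)" for k
  proof -
    have "\<beta> \<le> mixed_norm p q (restrict_to ({\<kappa> k..} \<times> UNIV) (z k))" by (rule \<beta>)
    also have "\<dots> \<le> K * (mixed_norm p q (fresh k) + mixed_norm p q (error k))"
      by (rule mixed_triangle_le(2)[OF parts_in(2,3) p q])
        (auto simp: restrict_to_def fresh_def error_def)
    also have "\<dots> \<le> K * (mixed_norm p q (fresh k) + \<beta> / (2 * K))"
      using error_le[of k] \<beta>(2) K_ge by (intro mult_left_mono) auto
    finally show ?thesis using K_ge by (simp add: field_simps)
  qed
  then have "real m powr enn2real (1 / q) * (\<beta> / (2 * K)) \<le> mixed_norm p q (\<Sum>k<m. fresh k)"
    unfolding mixed_norm_def
  proof (intro lp_disjoint_lower[where a = "\<lambda>k i. lp_norm p (fresh k i)", OF q m _ mixed_memD(2)[OF sums_in(2)]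
          mixed_memD(2)[OF parts_in(2)]])
    show "0 \<le> \<beta> / (2 * K)" using \<beta>(1) K_ge by simp
    show "j = k" if "lp_norm p (fresh j i) \<noteq> 0" "lp_norm p (fresh k i) \<noteq> 0" for i j k
      by (rule fresh_norm_disjoint[OF that])
  qed (simp_all only: norm_fresh_sum_row)
  then show ?thesis by (simp add: mult_ac)
qed

lemma fresh_small:
  assumes "\<And>k. mixed_norm p q (restrict_to ({\<kappa> k..} \<times> UNIV) (z k)) \<le> \<eta> / (2 * K) ^ Suc k"
  shows "mixed_norm p q (\<Sum>k<m. fresh k) \<le> \<eta>"
proof (rule mixed_sum_small[OF p q parts_in(2) _ \<eta>])
  fix k
  have "mixed_norm p q (fresh k) \<le> mixed_norm p q (restrict_to ({\<kappa> k..} \<times> UNIV) (z k))"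
    unfolding fresh_def by (rule restrict_to_mono[OF z p q]) auto
  also note assms
  finally show "mixed_norm p q (fresh k) \<le> \<eta> / (2 * K) ^ Suc k" .
qed

end

section \<open>Growth along a subsequence of a coordinatewise null sequence\<close>

text \<open>The set is a finite union of whole rows with c_i = 0, where the row norms tend to 0, and
  of single entries, where coordinatewise convergence suffices.\<close>

lemma vanishing_part_tendsto_0:
  fixes y :: "nat \<Rightarrow> nat \<Rightarrow> nat \<Rightarrow> 'a::real_normed_field"
  assumes p: "0 < p" "0 < q" and y: "\<And>n. y n \<in> mixed_space p q"
    and coord: "\<And>i j. (\<lambda>n. y n i j) \<longlonglongrightarrow> 0"
    and row: "\<And>i. (\<lambda>n. lp_norm p (y n i)) \<longlonglongrightarrow> c i"
  shows "(\<lambda>n. mixed_norm p q (restrict_to {(i, j). i < a \<and> (c i = 0 \<or> j < a)} (y n))) \<longlonglongrightarrow> 0"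
proof -
  have single: "(\<lambda>n. mixed_norm p q (restrict_to ({i} \<times> {j}) (y n))) \<longlonglongrightarrow> 0" for i j
  proof -
    have "mixed_norm p q (restrict_to ({i} \<times> {j}) (y n)) = norm (y n i j)" for n
      unfolding mixed_norm_restrict_to_row[OF p] by (subst lp_norm_single[OF p(1), of j]) auto
    then show ?thesis using coord by (simp add: tendsto_norm_zero)
  qed
  have "(\<lambda>n. mixed_norm p q (restrict_to ({i} \<times> {j. c i = 0 \<or> j < a}) (y n))) \<longlonglongrightarrow> 0" for i
  proof (cases "c i = 0")
    case True
    then show ?thesis
      using row[of i] by (simp add: mixed_norm_restrict_to_row[OF p] tendsto_rabs_zero)
  next
    case False
    have "(\<lambda>n. mixed_norm p q (restrict_to (\<Union>j\<in>{..<a}. {i} \<times> {j}) (y n))) \<longlonglongrightarrow> 0"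
      by (rule restrict_to_Union_tendsto_0[OF y p _ single]) simp
    moreover have "(\<Union>j\<in>{..<a}. {i} \<times> {j}) = {i} \<times> {j. c i = 0 \<or> j < a}" using False by auto
    ultimately show ?thesis by simp
  qed
  then have "(\<lambda>n. mixed_norm p q (restrict_to (\<Union>i\<in>{..<a}. {i} \<times> {j. c i = 0 \<or> j < a}) (y n))) \<longlonglongrightarrow> 0"
    by (intro restrict_to_Union_tendsto_0[OF y p]) auto
  moreover have "(\<Union>i\<in>{..<a}. {i} \<times> {j. c i = 0 \<or> j < a}) = {(i, j). i < a \<and> (c i = 0 \<or> j < a)}" by auto
  ultimately show ?thesis by simp
qed

text \<open>\<open>P\<close> and \<open>Q\<close> say which contribution is present. The additive 1
  leaves room for the accumulated error of the gliding hump.\<close>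

lemma two_exponent_growth:
  fixes Y :: "nat \<Rightarrow> real"
  assumes "0 \<le> \<alpha>" "0 \<le> \<beta>" "P \<or> Q"
    and P: "P \<Longrightarrow> \<exists>C>0. \<forall>m\<ge>1. real m powr \<alpha> \<le> C * (Y m + 1)"
    and Q: "Q \<Longrightarrow> \<exists>C>0. \<forall>m\<ge>1. real m powr \<beta> \<le> C * (Y m + 1)"
    and upper: "\<And>m. m \<ge> 1 \<Longrightarrow>
      Y m \<le> C * ((if P then real m powr \<alpha> else 0) + (if Q then real m powr \<beta> else 0) + 1)"
    and C: "0 \<le> C"
  shows "\<exists>\<gamma>\<in>{\<alpha>, \<beta>}. \<exists>C>0. \<forall>m\<ge>1. real m powr \<gamma> \<le> C * (Y m + 1) \<and> Y m \<le> C * real m powr \<gamma>"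
proof -
  \<comment> \<open>The largest exponent among the contributions that are present.\<close>
  have "\<exists>\<gamma>\<in>{\<alpha>, \<beta>}. (P \<longrightarrow> \<alpha> \<le> \<gamma>) \<and> (Q \<longrightarrow> \<beta> \<le> \<gamma>) \<and> (\<gamma> = \<alpha> \<and> P \<or> \<gamma> = \<beta> \<and> Q)"
    using assms(3) by (metis insertCI linorder_le_cases order_refl)
  then obtain \<gamma> where \<gamma>: "\<gamma> \<in> {\<alpha>, \<beta>}" "P \<Longrightarrow> \<alpha> \<le> \<gamma>" "Q \<Longrightarrow> \<beta> \<le> \<gamma>" "\<gamma> = \<alpha> \<and> P \<or> \<gamma> = \<beta> \<and> Q"
    by blast
  then obtain C' where C': "C' > 0" "\<And>m. m \<ge> 1 \<Longrightarrow> real m powr \<gamma> \<le> C' * (Y m + 1)"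
    using P Q by blast
  have up: "Y m \<le> 3 * C * real m powr \<gamma>" if m: "m \<ge> 1" for m
  proof -
    have "0 \<le> \<gamma>" using \<gamma>(1) assms by auto
    then have "1 \<le> real m powr \<gamma>" using m by (simp add: ge_one_powr_ge_zero)
    moreover have "(if P then real m powr \<alpha> else 0) \<le> real m powr \<gamma>"
      using \<gamma>(2) m by (auto intro!: powr_mono)
    moreover have "(if Q then real m powr \<beta> else 0) \<le> real m powr \<gamma>"
      using \<gamma>(3) m by (auto intro!: powr_mono)
    ultimately have "(if P then real m powr \<alpha> else 0) + (if Q then real m powr \<beta> else 0) + 1
      \<le> 3 * real m powr \<gamma>" by linarith
    then have "C * ((if P then real m powr \<alpha> else 0) + (if Q then real m powr \<beta> else 0) + 1)
      \<le> C * (3 * real m powr \<gamma>)" by (rule mult_left_mono[OF _ C])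
    then show ?thesis using upper[OF m] by (simp add: mult_ac)
  qed
  show ?thesis
  proof (intro bexI[OF _ \<gamma>(1)] exI[of _ "C' + 3 * C"] conjI allI impI)
    show "0 < C' + 3 * C" using C C'(1) by simp
    fix m :: nat assume m: "1 \<le> m"
    \<comment> \<open>No sign of \<open>Y\<close> is assumed; positivity comes from the lower
      bound.\<close>
    have "0 < C' * (Y m + 1)" using C'(2)[OF m] m
      by (smt (verit) of_nat_0_less_iff powr_gt_zero less_le_trans zero_less_one of_nat_le_0_iff not_one_le_zero)
    then have "0 \<le> Y m + 1" using C'(1) by (simp add: zero_less_mult_iff)
    then have "C' * (Y m + 1) \<le> (C' + 3 * C) * (Y m + 1)" using C by (intro mult_right_mono) auto
    then show "real m powr \<gamma> \<le> (C' + 3 * C) * (Y m + 1)" using C'(2)[OF m] by linarith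
    have "3 * C * real m powr \<gamma> \<le> (C' + 3 * C) * real m powr \<gamma>" using C'(1) by (intro mult_right_mono) auto
    then show "Y m \<le> (C' + 3 * C) * real m powr \<gamma>" using up[OF m] by linarith
  qed
qed

text \<open>\<open>P\<close> says that some row keeps its norm in the limit, \<open>T\<close> that
  norm persistently escapes through the rows. The lower bound \<open>d\<close> excludes that both
  fail.\<close>

lemma coordinatewise_null_growth:
  fixes y :: "nat \<Rightarrow> nat \<Rightarrow> nat \<Rightarrow> 'a::real_normed_field"
  assumes p: "0 < p" "0 < q" and y: "\<And>n. y n \<in> mixed_space p q"
    and coord: "\<And>i j. (\<lambda>n. y n i j) \<longlonglongrightarrow> 0"
    and row: "\<And>i. (\<lambda>n. lp_norm p (y n i)) \<longlonglongrightarrow> c i"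
    and B: "\<And>n. mixed_norm p q (y n) \<le> B"
    and d: "0 < d" "\<And>n. d \<le> mixed_norm p q (y n)"
  shows "\<exists>\<nu>. strict_mono \<nu> \<and> (\<exists>\<gamma>\<in>{enn2real (1 / p), enn2real (1 / q)}. \<exists>C>0. \<forall>m\<ge>1.
      real m powr \<gamma> \<le> C * (mixed_norm p q (\<Sum>k<m. y (\<nu> k)) + 1) \<and>
      mixed_norm p q (\<Sum>k<m. y (\<nu> k)) \<le> C * real m powr \<gamma>)"
proof -
  define K where "K = mixed_const p q"
  have K: "1 \<le> K" using mixed_const_ge by (simp add: K_def)
  have c: "0 \<le> c i" for i
    by (rule LIMSEQ_le_const[OF row]) (use lp_norm_nonneg[OF mixed_memD(1)[OF y]] in auto)
  define g where "g n a = mixed_norm p q (restrict_to ({a..} \<times> UNIV) (y n))" for n a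
  define S where "S a = {(i, j). i < a \<and> (c i = 0 \<or> j < a)}" for a :: nat
  have g_mono: "g n b \<le> g n a" if "a \<le> b" for n a b
    unfolding g_def by (rule restrict_to_mono[OF y p]) (use that in auto)
  have S_null: "(\<lambda>n. mixed_norm p q (restrict_to (S a) (y n))) \<longlonglongrightarrow> 0" for a
    unfolding S_def by (rule vanishing_part_tendsto_0[OF p y coord row])
  \<comment> \<open>If \<open>T\<close> fails, then for every \<beta> > 0 some \<open>a\<close> has
    g n a < \<beta> for all large n.\<close>
  define T where "T \<longleftrightarrow> (\<exists>\<beta>>0. \<forall>a. \<exists>\<^sub>F n in sequentially. \<beta> \<le> g n a)"
  define P where "P \<longleftrightarrow> (\<exists>i. c i \<noteq> 0)"
  obtain \<beta> where \<beta>: "0 < \<beta>" "T \<Longrightarrow> \<exists>\<^sub>F n in sequentially. \<beta> \<le> g n a" for a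
    unfolding T_def by (metis zero_less_one)
  obtain i0 where i0: "P \<Longrightarrow> c i0 \<noteq> 0" unfolding P_def by blast
  \<comment> \<open>The bound 1 is for the additive 1 in the growth estimates, the other two are
    what \<open>fresh_lower\<close> and \<open>steady_lower\<close> tolerate.\<close>
  define \<eta> where "\<eta> = min (min 1 (\<beta> / (2 * K))) (if P then c i0 / (4 * K) else 1)"
  have eta: "0 < \<eta>" "\<eta> \<le> 1" "\<eta> \<le> \<beta> / (2 * K)" "P \<Longrightarrow> \<eta> \<le> c i0 / (4 * K)"
    using \<beta>(1) K i0 c[of i0] by (auto simp: \<eta>_def)
  \<comment> \<open>Two errors of this size, joined at the cost of K, exhaust exactly the budget
    \<eta> / (2K)^{k+1} of step k.\<close>
  define \<delta> where "\<delta> k = \<eta> / (2 * K) ^ Suc (Suc k)" for k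
  have \<delta>: "0 < \<delta> k" "K * (\<delta> k + \<delta> k) = \<eta> / (2 * K) ^ Suc k" "\<delta> k \<le> \<eta> / (2 * K) ^ Suc k" for k
  proof -
    show pos: "0 < \<delta> k" using eta(1) K by (simp add: \<delta>_def)
    show eq: "K * (\<delta> k + \<delta> k) = \<eta> / (2 * K) ^ Suc k" using K by (simp add: \<delta>_def field_simps)
    have "\<delta> k \<le> 1 * (\<delta> k + \<delta> k)" using pos by simp
    also have "\<dots> \<le> K * (\<delta> k + \<delta> k)" using K pos by (intro mult_right_mono) auto
    finally show "\<delta> k \<le> \<eta> / (2 * K) ^ Suc k" unfolding eq .
  qed
  \<comment> \<open>Under \<open>T\<close> this can be had for every \<open>a\<close>; otherwise
    only once \<open>a\<close> is large enough for \<delta> k, which is why thresholds depending on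
    k appear.\<close>
  define G where "G k n a \<longleftrightarrow> (if T then \<beta> \<le> g n a else g n a \<le> \<delta> k)" for k n a
  have "\<exists>l. \<forall>a\<ge>l. \<exists>\<^sub>F n in sequentially. G k n a" for k
  proof (cases T)
    case True
    then show ?thesis using \<beta>(2) by (simp add: G_def)
  next
    case False
    then obtain l where "\<forall>\<^sub>F n in sequentially. \<not> \<delta> k \<le> g n l"
      using \<delta>(1)[of k] unfolding T_def not_frequently[symmetric] by blast
    then have "\<forall>\<^sub>F n in sequentially. G k n a" if "a \<ge> l" for a
    proof (rule eventually_mono)
      show "G k n a" if "\<not> \<delta> k \<le> g n l" for n
        using that False g_mono[OF \<open>a \<ge> l\<close>, of n] by (simp add: G_def)
    qed
    then show ?thesis using eventually_frequently[OF sequentially_bot] by blast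
  qed
  then obtain L where L: "\<And>k a. a \<ge> L k \<Longrightarrow> \<exists>\<^sub>F n in sequentially. G k n a" by metis
  define R where "R k n a b \<longleftrightarrow> G k n a
     \<and> (\<forall>i<a. c i \<noteq> 0 \<longrightarrow> c i / 2 \<le> lp_norm p (y n i) \<and> lp_norm p (y n i) \<le> 2 * c i)
     \<and> mixed_norm p q (restrict_to (S a) (y n)) \<le> \<delta> k
     \<and> mixed_norm p q (restrict_to (- ({..<b} \<times> {..<b})) (y n)) \<le> \<delta> k" for k n a b
  have "\<exists>n>n0. \<exists>b>a. b \<ge> L (Suc k) \<and> R k n a b" if a: "a \<ge> L k" for k a n0
  proof -
    have "\<forall>\<^sub>F n in sequentially. mixed_norm p q (restrict_to (S a) (y n)) < \<delta> k"
      by (rule order_tendstoD(2)[OF S_null \<delta>(1)])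
    moreover have "\<forall>\<^sub>F n in sequentially. \<forall>i\<in>{..<a}. c i \<noteq> 0 \<longrightarrow>
        c i / 2 < lp_norm p (y n i) \<and> lp_norm p (y n i) < 2 * c i"
    proof (intro eventually_ball_finite ballI)
      fix i
      show "\<forall>\<^sub>F n in sequentially. c i \<noteq> 0 \<longrightarrow> c i / 2 < lp_norm p (y n i) \<and> lp_norm p (y n i) < 2 * c i"
      proof (cases "c i = 0")
        case False
        then have "c i / 2 < c i" "c i < 2 * c i" using c[of i] by auto
        from order_tendstoD(1)[OF row this(1)] order_tendstoD(2)[OF row this(2)]
        show ?thesis by eventually_elim simp
      qed simp
    qed simp
    moreover have "\<forall>\<^sub>F n in sequentially. n > n0" by (rule eventually_gt_at_top)
    ultimately have "\<forall>\<^sub>F n in sequentially. n > n0 \<and> mixed_norm p q (restrict_to (S a) (y n)) < \<delta> k \<and>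
      (\<forall>i\<in>{..<a}. c i \<noteq> 0 \<longrightarrow> c i / 2 < lp_norm p (y n i) \<and> lp_norm p (y n i) < 2 * c i)"
      by eventually_elim blast
    \<comment> \<open>Escaping norm is available only for infinitely many n; it can be combined with
      the other conditions because those hold for all large n.\<close>
    from frequently_ex[OF frequently_eventually_conj[OF L[OF a] this]]
    obtain n where n: "n > n0" "mixed_norm p q (restrict_to (S a) (y n)) < \<delta> k" "G k n a"
      "\<And>i. i < a \<Longrightarrow> c i \<noteq> 0 \<Longrightarrow> c i / 2 < lp_norm p (y n i) \<and> lp_norm p (y n i) < 2 * c i"
      by auto
    have "\<forall>\<^sub>F b in sequentially. mixed_norm p q (restrict_to (- ({..<b} \<times> {..<b})) (y n)) < \<delta> k"
      by (rule order_tendstoD(2)[OF restrict_to_corner_complement_tendsto_0[OF y p] \<delta>(1)])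
    moreover have "\<forall>\<^sub>F b in sequentially. b > a" by (rule eventually_gt_at_top)
    moreover have "\<forall>\<^sub>F b in sequentially. b \<ge> L (Suc k)" by (rule eventually_ge_at_top)
    ultimately have "\<forall>\<^sub>F b in sequentially. b > a \<and> b \<ge> L (Suc k) \<and>
      mixed_norm p q (restrict_to (- ({..<b} \<times> {..<b})) (y n)) < \<delta> k"
      by eventually_elim blast
    from eventually_happens'[OF sequentially_bot this]
    obtain b where b: "b > a" "b \<ge> L (Suc k)"
      "mixed_norm p q (restrict_to (- ({..<b} \<times> {..<b})) (y n)) < \<delta> k" by blast
    have "R k n a b" unfolding R_def using n b by (simp add: less_imp_le)
    then show ?thesis using n(1) b by blast
  qed
  \<comment> \<open>Starting at \<open>Suc i0\<close> puts row \<open>i0\<close> below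
    \<open>\<kappa> 0\<close>, as \<open>steady_lower\<close> requires.\<close>
  from interleaved_choice[of L R "Suc i0", OF this]
  obtain \<nu> \<kappa> where \<nu>: "strict_mono \<nu>" and \<kappa>: "strict_mono \<kappa>" "Suc i0 \<le> \<kappa> 0"
    and R: "\<And>k. R k (\<nu> k) (\<kappa> k) (\<kappa> (Suc k))" by blast
  have gG: "G k (\<nu> k) (\<kappa> k)" for k using R by (simp add: R_def)
  interpret gliding_hump p q "\<lambda>k. y (\<nu> k)" \<kappa> c B \<eta>
  proof
    fix k
    have "mixed_norm p q (restrict_to (S (\<kappa> k) \<union> - ({..<\<kappa> (Suc k)} \<times> {..<\<kappa> (Suc k)})) (y (\<nu> k)))
      \<le> K * (mixed_norm p q (restrict_to (S (\<kappa> k)) (y (\<nu> k)))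
        + mixed_norm p q (restrict_to (- ({..<\<kappa> (Suc k)} \<times> {..<\<kappa> (Suc k)})) (y (\<nu> k))))"
      unfolding K_def by (rule restrict_to_union[OF y p])
    also have "\<dots> \<le> K * (\<delta> k + \<delta> k)"
      using R[of k] K by (intro mult_left_mono add_mono) (auto simp: R_def)
    finally show "mixed_norm p q (restrict_to ({(i, j). i < \<kappa> k \<and> (c i = 0 \<or> j < \<kappa> k)} \<union>
        - ({..<\<kappa> (Suc k)} \<times> {..<\<kappa> (Suc k)})) (y (\<nu> k))) \<le> \<eta> / (2 * mixed_const p q) ^ Suc k"
      using \<delta>(2)[of k] by (simp only: S_def K_def)
  next
    fix i k assume "i < \<kappa> k" "c i \<noteq> 0"
    then show "c i / 2 \<le> lp_norm p (y (\<nu> k) i) \<and> lp_norm p (y (\<nu> k) i) \<le> 2 * c i"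
      using R[of k] by (simp add: R_def)
  qed (use p y B \<kappa> c eta in auto)
  let ?Y = "\<lambda>m. mixed_norm p q (\<Sum>k<m. y (\<nu> k))"
  \<comment> \<open>Otherwise the first a rows and the remaining rows both become small for a
    suitable a, and together they carry all of \<open>y n\<close>.\<close>
  have PT: "P \<or> T"
  proof (rule ccontr)
    assume "\<not> (P \<or> T)"
    then have "\<not> T" and c0: "\<And>i. c i = 0" by (auto simp: P_def)
    moreover have "0 < d / (2 * K)" using d(1) K by simp
    ultimately obtain a where a: "\<forall>\<^sub>F n in sequentially. \<not> d / (2 * K) \<le> g n a"
      unfolding T_def not_frequently[symmetric] by blast
    moreover have "\<forall>\<^sub>F n in sequentially. mixed_norm p q (restrict_to (S a) (y n)) < d / (2 * K)"
      using d(1) K by (intro order_tendstoD(2)[OF S_null]) simp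
    ultimately have "\<forall>\<^sub>F n in sequentially. False"
    proof eventually_elim
      case (elim n)
      have "S a \<union> ({a..} \<times> UNIV) = UNIV" using c0 by (auto simp: S_def)
      then have "mixed_norm p q (y n) \<le> K * (mixed_norm p q (restrict_to (S a) (y n)) + g n a)"
        using restrict_to_union[OF y p q, of "S a" "{a..} \<times> UNIV" n] by (simp add: restrict_to_UNIV K_def g_def)
      also have "\<dots> < K * (d / (2 * K) + d / (2 * K))"
        using elim K by (intro mult_strict_left_mono add_strict_mono) auto
      also have "\<dots> = d" using K by simp
      finally show False using d(2)[of n] by simp
    qed
    then show False by simp
  qed
  have divide_out: "h \<le> K / u * Z" if "0 < u" "u * h \<le> K * Z" for h u Z :: real
    using that by (simp add: field_simps)
  have "\<exists>C>0. \<forall>m\<ge>1. real m powr enn2real (1 / p) \<le> C * (?Y m + 1)" if P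
  proof (intro exI[of _ "K / (c i0 / (4 * K))"] conjI allI impI)
    have pos: "0 < c i0 / (4 * K)" using i0[OF that] c[of i0] K by simp
    then show "0 < K / (c i0 / (4 * K))" using divide_pos_pos[of K] K by fastforce
    fix m :: nat assume m: "1 \<le> m"
    have "c i0 / (4 * K) * real m powr enn2real (1 / p) \<le> K * (?Y m + \<eta>)"
      using order_trans[OF steady_lower[OF m, of i0] steady_sum_le] \<kappa>(2) i0[OF that] eta(4)[OF that]
      by (simp add: K_def)
    also have "\<dots> \<le> K * (?Y m + 1)" using eta(2) K by (intro mult_left_mono) auto
    finally show "real m powr enn2real (1 / p) \<le> K / (c i0 / (4 * K)) * (?Y m + 1)"
      by (rule divide_out[OF pos])
  qed
  moreover have "\<exists>C>0. \<forall>m\<ge>1. real m powr enn2real (1 / q) \<le> C * (?Y m + 1)" if T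
  proof (intro exI[of _ "K / (\<beta> / (2 * K))"] conjI allI impI)
    have pos: "0 < \<beta> / (2 * K)" using \<beta>(1) K by simp
    then show "0 < K / (\<beta> / (2 * K))" using divide_pos_pos[of K] K by fastforce
    fix m :: nat assume m: "1 \<le> m"
    have "\<beta> \<le> mixed_norm p q (restrict_to ({\<kappa> k..} \<times> UNIV) (y (\<nu> k)))" for k
      using gG[of k] that by (simp add: G_def g_def)
    then have "\<beta> / (2 * K) * real m powr enn2real (1 / q) \<le> K * (?Y m + \<eta>)"
      using order_trans[OF fresh_lower[OF m, of \<beta>] fresh_sum_le] \<beta>(1) eta(3) by (simp add: K_def)
    also have "\<dots> \<le> K * (?Y m + 1)" using eta(2) K by (intro mult_left_mono) auto
    finally show "real m powr enn2real (1 / q) \<le> K / (\<beta> / (2 * K)) * (?Y m + 1)"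
      by (rule divide_out[OF pos])
  qed
  \<comment> \<open>K is paid twice, for joining steady with fresh and for adding the error. Of the
    two \<eta> in the bracket, one allows for negligible fresh parts; as \<eta> \<le> 1, they
    account for the 2 in 4B + 2.\<close>
  moreover have "?Y m \<le> (K * K * (4 * B + 2)) * ((if P then real m powr enn2real (1 / p) else 0)
      + (if T then real m powr enn2real (1 / q) else 0) + 1)" if m: "m \<ge> 1" for m
  proof -
    let ?hp = "if P then real m powr enn2real (1 / p) else 0"
    let ?hq = "if T then real m powr enn2real (1 / q) else 0"
    have st: "mixed_norm p q (\<Sum>k<m. steady k) \<le> 4 * B * ?hp"
      using steady_upper[OF m] steady_zero[of m] by (auto simp: P_def)
    have fr: "mixed_norm p q (\<Sum>k<m. fresh k) \<le> B * ?hq + \<eta>"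
    proof (cases T)
      case True
      then show ?thesis using fresh_upper[OF m] eta(1) by simp
    next
      case False
      have "mixed_norm p q (restrict_to ({\<kappa> k..} \<times> UNIV) (y (\<nu> k))) \<le> \<eta> / (2 * mixed_const p q) ^ Suc k" for k
        using gG[of k] False \<delta>(3)[of k] by (simp add: G_def g_def K_def)
      from fresh_small[OF this] False show ?thesis by simp
    qed
    have "?Y m \<le> K * (K * (mixed_norm p q (\<Sum>k<m. steady k) + mixed_norm p q (\<Sum>k<m. fresh k)) + \<eta>)"
      unfolding K_def by (rule sum_le)
    also have "\<dots> \<le> K * (K * (4 * B * ?hp + (B * ?hq + \<eta>)) + K * \<eta>)"
      using K st fr eta(1) by (intro mult_left_mono add_mono) (auto simp: mult_le_cancel_right1)
    also have "\<dots> = (K * K) * (4 * B * ?hp + B * ?hq + 2 * \<eta>)" by (simp only: algebra_simps)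
    also have "\<dots> \<le> (K * K) * ((4 * B + 2) * (?hp + ?hq + 1))"
    proof (rule mult_left_mono)
      have "0 \<le> ?hp" "0 \<le> ?hq" "0 \<le> B * ?hq" using B_nonneg by auto
      then show "4 * B * ?hp + B * ?hq + 2 * \<eta> \<le> (4 * B + 2) * (?hp + ?hq + 1)"
        using B_nonneg eta(2) by (simp only: distrib_left distrib_right mult_1_right)
    qed (use K in simp)
    finally show ?thesis by (simp only: mult.assoc)
  qed
  moreover have "0 \<le> K * K * (4 * B + 2)" using K B_nonneg by simp
  moreover note PT
  ultimately have "\<exists>\<gamma>\<in>{enn2real (1 / p), enn2real (1 / q)}. \<exists>C>0. \<forall>m\<ge>1.
      real m powr \<gamma> \<le> C * (?Y m + 1) \<and> ?Y m \<le> C * real m powr \<gamma>"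
    by (intro two_exponent_growth[of _ _ P T]) auto
  then show ?thesis using \<nu> by blast
qed

section \<open>From squeeze-symmetric sequences to null sequences and back\<close>

lemma mixed_quasi_normed:
  assumes p: "0 < p" "0 < q"
  shows "quasi_normed_space mixed_scale (mixed_space p q) (mixed_norm p q) (mixed_const p q)"
proof -
  interpret vector_space mixed_scale by (rule vector_space_mixed_scale)
  show ?thesis
  proof
    show "subspace (mixed_space p q)"
      by (rule subspaceI) (use mixed_zero mixed_add(1)[OF _ _ p] mixed_norm_scale(1)[OF _ p] in auto)
    fix f :: "nat \<Rightarrow> nat \<Rightarrow> 'a" assume f: "f \<in> mixed_space p q" "mixed_norm p q f = 0"
    then have "f i j = 0" for i j using entry_norm_le[OF f(1) p, of i j] by simp
    then show "f = 0" by (simp add: fun_eq_iff)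
  qed (auto simp: mixed_norm_nonneg mixed_norm_scale[OF _ p] mixed_const_ge mixed_add[OF _ _ p])
qed

text \<open>The coefficients 1 and -1 have modulus 1, so sums of differences fall under
  superdemocracy, with twice as many vectors.\<close>

lemma sum_differences_reindex:
  fixes x :: "nat \<Rightarrow> nat \<Rightarrow> nat \<Rightarrow> 'a::real_normed_field" and s :: "nat \<Rightarrow> nat"
  assumes s: "strict_mono s" and F: "finite F"
  shows "\<exists>A \<epsilon>. finite A \<and> card A = 2 * card F \<and> (\<forall>n\<in>A. norm (\<epsilon> n) = 1) \<and>
    (\<Sum>k\<in>F. x (s (2 * k)) - x (s (2 * k + 1))) = (\<Sum>n\<in>A. mixed_scale (\<epsilon> n) (x n))"
proof -
  define \<sigma> :: "nat \<Rightarrow> 'a" where "\<sigma> j = (if even j then 1 else -1)" for j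
  define E where "E = (\<lambda>k. 2 * k) ` F"
  define O' where "O' = (\<lambda>k. 2 * k + 1) ` F"
  have inj: "inj s" using strict_mono_eq[OF s] by (auto intro: injI)
  have fin: "finite E" "finite O'" using F by (auto simp: E_def O'_def)
  have dis: "E \<inter> O' = {}" by (auto simp: E_def O'_def) presburger
  have "(\<Sum>k\<in>F. x (s (2 * k)) - x (s (2 * k + 1)))
      = (\<Sum>k\<in>F. mixed_scale (\<sigma> (2 * k)) (x (s (2 * k))))
        + (\<Sum>k\<in>F. mixed_scale (\<sigma> (2 * k + 1)) (x (s (2 * k + 1))))"
    unfolding sum.distrib[symmetric]
    by (intro sum.cong refl) (auto simp: \<sigma>_def mixed_scale_def seq_scale_def fun_eq_iff)
  also have "(\<Sum>k\<in>F. mixed_scale (\<sigma> (2 * k)) (x (s (2 * k)))) = (\<Sum>j\<in>E. mixed_scale (\<sigma> j) (x (s j)))"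
    unfolding E_def by (subst sum.reindex) (auto simp: inj_on_def)
  also have "(\<Sum>k\<in>F. mixed_scale (\<sigma> (2 * k + 1)) (x (s (2 * k + 1)))) = (\<Sum>j\<in>O'. mixed_scale (\<sigma> j) (x (s j)))"
    unfolding O'_def by (subst sum.reindex) (auto simp: inj_on_def)
  also have "(\<Sum>j\<in>E. mixed_scale (\<sigma> j) (x (s j))) + (\<Sum>j\<in>O'. mixed_scale (\<sigma> j) (x (s j)))
      = (\<Sum>j\<in>E \<union> O'. mixed_scale (\<sigma> j) (x (s j)))"
    by (rule sum.union_disjoint[OF fin dis, symmetric])
  \<comment> \<open>Signs belong to positions in the subsequence; \<open>inv s\<close> recovers the
    position from the index.\<close>
  also have "\<dots> = (\<Sum>n\<in>s ` (E \<union> O'). mixed_scale (\<sigma> (inv s n)) (x n))"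
    by (subst sum.reindex[OF inj_on_subset[OF inj]]) (auto simp: inv_f_f[OF inj])
  finally have eq: "(\<Sum>k\<in>F. x (s (2 * k)) - x (s (2 * k + 1)))
      = (\<Sum>n\<in>s ` (E \<union> O'). mixed_scale (\<sigma> (inv s n)) (x n))" .
  have "card (s ` (E \<union> O')) = card E + card O'"
    using fin dis inj by (simp add: card_image inj_on_subset card_Un_disjoint)
  also have "\<dots> = 2 * card F" by (simp add: E_def O'_def card_image inj_on_def)
  finally have "card (s ` (E \<union> O')) = 2 * card F" .
  then show ?thesis using fin eq
    by (intro exI[of _ "s ` (E \<union> O')"] exI[of _ "\<lambda>n. \<sigma> (inv s n)"]) (auto simp: \<sigma>_def)
qed

text \<open>The class \<open>heine_borel\<close> covers both scalar fields and provides convergent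
  subsequences of bounded scalars. Only superdemocracy is kept from squeeze-symmetry, so growth
  found on one family of signed sums transfers to all.\<close>

lemma squeeze_symmetric_growth:
  fixes x :: "nat \<Rightarrow> nat \<Rightarrow> nat \<Rightarrow> 'a::{real_normed_field, heine_borel}"
  assumes p: "0 < p" "0 < q"
    and sq: "squeeze_symmetric_sequence mixed_scale (mixed_space p q) (mixed_norm p q) x"
  shows "\<exists>r\<in>{p, q}. seq_equivalent (phi_us mixed_scale (mixed_norm p q) x)
    (\<lambda>m. ennreal (real m powr enn2real (1 / r)))"
proof -
  let ?N = "mixed_norm p q"
  note qn = mixed_quasi_normed[OF p, where 'a = 'a]
  have x: "x n \<in> mixed_space p q" and x_pos: "0 < ?N (x n)" for n
    using squeeze_symmetric_superdemocratic(2,3)[OF qn sq] by auto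
  obtain D where D: "D > 0" and dem: "\<And>A B \<epsilon> \<eta>. finite A \<Longrightarrow> finite B \<Longrightarrow> card B \<le> 2 * card A \<Longrightarrow>
      \<forall>n\<in>B. norm (\<epsilon> n) = 1 \<Longrightarrow> \<forall>n\<in>A. norm (\<eta> n) = 1 \<Longrightarrow>
      ?N (\<Sum>n\<in>B. mixed_scale (\<epsilon> n) (x n)) \<le> D * ?N (\<Sum>n\<in>A. mixed_scale (\<eta> n) (x n))"
    using squeeze_symmetric_superdemocratic(1)[OF qn sq] by blast
  have scale_1: "mixed_scale 1 f = f" for f :: "nat \<Rightarrow> nat \<Rightarrow> 'a"
    by (simp add: mixed_scale_def seq_scale_def)
  have x_bdd: "?N (x n) \<le> D * ?N (x 0)" for n
    using dem[of "{0}" "{n}" "\<lambda>_. 1" "\<lambda>_. 1"] by (simp add: scale_1)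
  have "norm (case ij of (i, j) \<Rightarrow> x n i j) \<le> D * ?N (x 0)" for n ij
    using order_trans[OF entry_norm_le[OF x p] x_bdd] by (simp split: prod.splits)
  note seq = function_convergent_subsequence[OF countableI_type[of UNIV] this]
  obtain s where s: "strict_mono s"
    and s_lim: "\<And>ij. ij \<in> UNIV \<Longrightarrow> \<exists>l. (\<lambda>n. case ij of (i, j) \<Rightarrow> x (s n) i j) \<longlonglongrightarrow> l"
    by (rule seq, rule that)
  \<comment> \<open>The subsequence converges in every coordinate, so differences of its disjoint
    consecutive pairs are null there wherever the limit lies.\<close>
  define y where "y n = x (s (2 * n)) - x (s (2 * n + 1))" for n
  have y: "y n \<in> mixed_space p q" for n unfolding y_def by (rule mixed_diff[OF x x p])
  have y_null: "(\<lambda>n. y n i j) \<longlonglongrightarrow> 0" for i j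
  proof -
    obtain l where l: "(\<lambda>n. x (s n) i j) \<longlonglongrightarrow> l" using s_lim[of "(i, j)"] by auto
    have "(\<lambda>n. x (s (2 * n)) i j) \<longlonglongrightarrow> l" "(\<lambda>n. x (s (2 * n + 1)) i j) \<longlonglongrightarrow> l"
      using LIMSEQ_subseq_LIMSEQ[OF l, of "\<lambda>n. 2 * n"] LIMSEQ_subseq_LIMSEQ[OF l, of "\<lambda>n. 2 * n + 1"]
      by (auto simp: strict_mono_def o_def)
    from tendsto_diff[OF this] show ?thesis by (simp add: y_def)
  qed
  have y_sum: "\<exists>A \<epsilon>. finite A \<and> card A = 2 * card F \<and> (\<forall>n\<in>A. norm (\<epsilon> n) = 1) \<and>
    (\<Sum>k\<in>F. y k) = (\<Sum>n\<in>A. mixed_scale (\<epsilon> n) (x n))" if "finite F" for F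
    unfolding y_def by (rule sum_differences_reindex[OF s that])
  have y_bdd: "?N (y n) \<le> D * ?N (x 0)" and y_low: "?N (x 0) / D \<le> ?N (y n)" for n
  proof -
    obtain A \<epsilon> where A: "finite A" "card A = 2" "\<forall>n\<in>A. norm (\<epsilon> n) = 1"
      "y n = (\<Sum>n\<in>A. mixed_scale (\<epsilon> n) (x n))" using y_sum[of "{n}"] by auto
    show "?N (y n) \<le> D * ?N (x 0)"
      using dem[of "{0}" A \<epsilon> "\<lambda>_. 1"] A by (simp add: scale_1)
    show "?N (x 0) / D \<le> ?N (y n)"
      using dem[of A "{0}" "\<lambda>_. 1" \<epsilon>] A D by (simp add: scale_1 pos_divide_le_eq mult.commute)
  qed
  have "norm (lp_norm p (y n i)) \<le> D * ?N (x 0)" for n i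
    using order_trans[OF row_norm_le[OF y p(2)] y_bdd] lp_norm_nonneg[OF mixed_memD(1)[OF y]] by simp
  note seq = function_convergent_subsequence[OF countableI_type[of UNIV] this]
  obtain t where t: "strict_mono t"
    and "\<And>i. i \<in> UNIV \<Longrightarrow> \<exists>l. (\<lambda>n. lp_norm p (y (t n) i)) \<longlonglongrightarrow> l"
    by (rule seq, rule that)
  then have "\<forall>i. \<exists>l. (\<lambda>n. lp_norm p (y (t n) i)) \<longlonglongrightarrow> l" by blast
  then obtain c where c: "\<And>i. (\<lambda>n. lp_norm p (y (t n) i)) \<longlonglongrightarrow> c i" by metis
  have yt_null: "(\<lambda>n. y (t n) i j) \<longlonglongrightarrow> 0" for i j
    using LIMSEQ_subseq_LIMSEQ[OF y_null t] by (simp add: o_def)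
  obtain \<nu> \<gamma> C where \<nu>: "strict_mono \<nu>" and \<gamma>: "\<gamma> \<in> {enn2real (1 / p), enn2real (1 / q)}" and C: "C > 0"
    and lower: "\<And>m. m \<ge> 1 \<Longrightarrow> real m powr \<gamma> \<le> C * (?N (\<Sum>k<m. y (t (\<nu> k))) + 1)"
    and upper: "\<And>m. m \<ge> 1 \<Longrightarrow> ?N (\<Sum>k<m. y (t (\<nu> k))) \<le> C * real m powr \<gamma>"
    using coordinatewise_null_growth[of p q "\<lambda>n. y (t n)" c, OF p y yt_null c y_bdd _ y_low] x_pos[of 0] D
    by auto
  define d where "d = ?N (x 0) / D"
  have d: "0 < d" using x_pos D by (simp add: d_def)
  have Y_sum: "\<exists>A \<epsilon>. finite A \<and> card A = 2 * m \<and> (\<forall>n\<in>A. norm (\<epsilon> n) = 1) \<and>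
    (\<Sum>k<m. y (t (\<nu> k))) = (\<Sum>n\<in>A. mixed_scale (\<epsilon> n) (x n))" for m
  proof -
    have inj: "inj_on (t \<circ> \<nu>) {..<m}"
      using strict_mono_eq[OF strict_mono_o[OF t \<nu>]] by (auto intro: inj_onI)
    have "(\<Sum>k<m. y (t (\<nu> k))) = (\<Sum>k\<in>(t \<circ> \<nu>) ` {..<m}. y k)"
      unfolding sum.reindex[OF inj] by simp
    then show ?thesis using y_sum[of "(t \<circ> \<nu>) ` {..<m}"] card_image[OF inj] by simp
  qed
  \<comment> \<open>The first entry serves the upper bound, the second the lower bound, where 1 +
    1/d absorbs the additive 1.\<close>
  define M where "M = max (D * C) (C * (1 + 1 / d) * D)"
  have M: "M > 0" "D * C \<le> M" "C * (1 + 1 / d) * D \<le> M"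
    using C D by (auto simp: M_def less_max_iff_disj)
  have "seq_equivalent (phi_us mixed_scale ?N x) (\<lambda>m. ennreal (real m powr \<gamma>))"
    unfolding seq_equivalent_def
  proof (intro exI[of _ M] conjI allI impI M(1))
    fix m :: nat assume m: "1 \<le> m"
    obtain A \<epsilon> where A: "finite A" "card A = 2 * m" "\<forall>n\<in>A. norm (\<epsilon> n) = 1"
      and Y: "(\<Sum>k<m. y (t (\<nu> k))) = (\<Sum>n\<in>A. mixed_scale (\<epsilon> n) (x n))" using Y_sum[of m] by blast
    show "phi_us mixed_scale ?N x m \<le> ennreal M * ennreal (real m powr \<gamma>)"
      unfolding phi_us_def
    proof (rule Sup_least, clarify)
      fix B and \<eta> :: "nat \<Rightarrow> 'a" assume B: "finite B" "card B \<le> m" "\<forall>n\<in>B. norm (\<eta> n) = 1"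
      \<comment> \<open>The 2m vectors behind m differences dominate any signed sum of at most m
        vectors.\<close>
      have "?N (\<Sum>n\<in>B. mixed_scale (\<eta> n) (x n)) \<le> D * ?N (\<Sum>n\<in>A. mixed_scale (\<epsilon> n) (x n))"
        using dem[of A B \<eta> \<epsilon>] A B by simp
      also have "\<dots> \<le> D * (C * real m powr \<gamma>)"
        using upper[OF m] D unfolding Y by (intro mult_left_mono) auto
      also have "\<dots> \<le> M * real m powr \<gamma>"
        using M(2) mult_right_mono[OF M(2), of "real m powr \<gamma>"] by (simp add: mult.assoc)
      finally show "ennreal (?N (\<Sum>n\<in>B. mixed_scale (\<eta> n) (x n))) \<le> ennreal M * ennreal (real m powr \<gamma>)"
        using M(1) by (simp add: ennreal_mult[symmetric] ennreal_leI)
    qed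
    let ?S = "?N (\<Sum>n<m. mixed_scale 1 (x n))"
    have S: "?N (\<Sum>k<m. y (t (\<nu> k))) \<le> D * ?S"
      unfolding Y using dem[of "{..<m}" A \<epsilon> "\<lambda>_. 1"] A by simp
    \<comment> \<open>Comparison with the single vector \<open>x 0\<close> keeps the sums away from
      0, so adding 1 changes them only by a factor.\<close>
    have "d \<le> ?N (\<Sum>k<m. y (t (\<nu> k)))"
      unfolding Y d_def using dem[of A "{0}" "\<lambda>_. 1" \<epsilon>] A m D
      by (simp add: scale_1 pos_divide_le_eq mult.commute)
    then have "?N (\<Sum>k<m. y (t (\<nu> k))) + 1 \<le> (1 + 1 / d) * ?N (\<Sum>k<m. y (t (\<nu> k)))"
      using d by (simp add: field_simps)
    then have "real m powr \<gamma> \<le> C * ((1 + 1 / d) * ?N (\<Sum>k<m. y (t (\<nu> k))))"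
      using lower[OF m] C by (meson mult_left_mono less_imp_le order_trans)
    also have "\<dots> \<le> C * ((1 + 1 / d) * (D * ?S))"
      using S C d by (intro mult_left_mono) auto
    also have "\<dots> = (C * (1 + 1 / d) * D) * ?S" by (simp only: mult.assoc)
    also have "\<dots> \<le> M * ?S"
      using M(3) by (intro mult_right_mono mixed_norm_nonneg mixed_sum_in[OF p]) (simp_all add: scale_1 x)
    finally have "ennreal (real m powr \<gamma>) \<le> ennreal M * ennreal ?S"
      using M(1) by (simp add: ennreal_mult'[symmetric] ennreal_leI)
    also have "ennreal ?S \<le> phi_us mixed_scale ?N x m"
      unfolding phi_us_def
      by (rule Sup_upper) (auto intro!: exI[of _ "{..<m}"] exI[of _ "\<lambda>_. 1"])
    finally show "ennreal (real m powr \<gamma>) \<le> ennreal M * phi_us mixed_scale ?N x m"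
      by (simp add: mult_left_mono)
  qed
  then show ?thesis using \<gamma> by blast
qed

theorem theorem5p7:
  fixes p q :: ennreal
  assumes "0 < p" and "0 < q"
  shows
    "(\<forall>x :: nat \<Rightarrow> (nat \<Rightarrow> nat \<Rightarrow> real).
        squeeze_symmetric_sequence mixed_scale (mixed_space p q) (mixed_norm p q) x \<longrightarrow>
        (\<exists>r\<in>{p, q}. seq_equivalent (phi_us mixed_scale (mixed_norm p q) x)
                       (\<lambda>m. ennreal (real m powr enn2real (1 / r))))) \<and>
     (\<forall>x :: nat \<Rightarrow> (nat \<Rightarrow> nat \<Rightarrow> complex).
        squeeze_symmetric_sequence mixed_scale (mixed_space p q) (mixed_norm p q) x \<longrightarrow>
        (\<exists>r\<in>{p, q}. seq_equivalent (phi_us mixed_scale (mixed_norm p q) x)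
                       (\<lambda>m. ennreal (real m powr enn2real (1 / r)))))"
  by (intro conjI allI impI squeeze_symmetric_growth assms)

end
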